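(* Let $I$ be a support with $|I|=k-1$ such that the weights $\Lambda_i$, $i\in I$, are linearly independent and $\Lambda_j|_{\mathfrak h_I}\neq0$ for every $j\in J=I^c$. Then $Z_I=\{z_j=0:j\in J\}$ is an irreducible component of the singular locus of the orbit foliation $\mathcal F$. Put $q=n-k\ge1$, choose $0\ne\xi_I\in\mathfrak h_I$ and put $\lambda_j=\Lambda_j(\xi_I)$ for $j\in J$. (1) For every homogeneous symmetric polynomial $\varphi$ of degree $q+1$ (in $q+1$ variables), the Baum--Bott coefficient of $\mathcal F$ along $Z_I$ is $$\operatorname{BB}_\varphi(\mathcal F;Z_I)=\frac{\varphi((\lambda_j)_{j\in J})}{\prod_{j\in J}\lambda_j}.$$ If $I$ has full resonance rank, the coordinate-labelled envelope determines all these coefficients. (2) If $q=1$ and $J=\{j_1,j_2\}$, the coordinate separatrices $\{w_{j_2}=0\}$ and $\{w_{j_1}=0\}$ of the residual transverse foliation have Camacho--Sad indices at $0$ equal to, respectively, $$\left(\frac{\lambda_{j_2}}{\lambda_{j_1}},\frac{\lambda_{j_1}}{\lambda_{j_2}}\right),$$ and the labelled envelope determines this ordered pair if and only if $I$ has full resonance rank, i.e. $\dim Q_I=n-k=1$. (3) Below full resonance rank there are families of diagonal actions in the Poincaré domain, with such supports $I$, having the same labelled envelope, the same logarithmic connection (with labelled support coordinates) and the same monodromy, but different transverse Camacho--Sad indices.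
   Context: Let $\mathfrak g=\mathbb C^k$ and let $\Lambda_1,\dots,\Lambda_n\in\mathfrak g^*$ span $\mathfrak g^*$. $\mathfrak g$ acts on $\mathbb C^n$ by $t\cdot z=(e^{\Lambda_j(t)}z_j)_j$; $\mathcal F$ is the singular foliation spanned by the fields $X_v=\sum_j\Lambda_j(v)z_j\partial/\partial z_j$, $v\in\mathfrak g$; its singular locus is the set of points whose orbit has dimension $<k$. The action is in the Poincaré domain if some $\xi\in\mathfrak g$ has $\operatorname{Re}\Lambda_j(\xi)>0$ for all $j$. For a support $I$: $J=I^c$, $\mathfrak h_I=\bigcap_{i\in I}\ker\Lambda_i$, $\mu_j=\Lambda_j|_{\mathfrak h_I}$, $S_I=\{\alpha\in\mathbb N^J:\sum_j\alpha_j\mu_j=0\}$ ($0\in\mathbb N$), $M_I=\operatorname{gp}(S_I)$, $Q_I=\operatorname{Spec}\mathbb C[S_I]$. Full resonance rank means $\dim Q_I=n-k$. Under the hypotheses of the claim, $\dim\mathfrak h_I=1$ and the foliation induced on a transversal $(\mathbb C^J,0)$ to $Z_I$ at a point of support exactly $I$ (the residual transverse foliation) is generated by $Y_I=\sum_{j\in J}\lambda_jw_j\,\partial/\partial w_j$, with isolated singularity $0$. The Baum--Bott coefficient $\operatorname{BB}_\varphi(\mathcal F;Z_I)$ is, by Baum--Bott localisation at a generic point of $Z_I$, the Grothendieck residue at $0$ of this transverse one-dimensional foliation, $\operatorname{Res}_0\left[\begin{smallmatrix}\varphi(DY_I)\,dw\\ Y_I^{1},\dots,Y_I^{q+1}\end{smallmatrix}\right]$,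 where $Y_I^1,\dots,Y_I^{q+1}$ are the components of $Y_I$, $DY_I$ is its Jacobian matrix and $\varphi$ is evaluated on eigenvalues. If a foliation germ on a surface with coordinates $(x,y)$ is generated by $a\,\partial_x+b\,\partial_y$ and $C=\{y=0\}$ is invariant, the Camacho--Sad index along $C$ at $0$ is $\operatorname{Res}_{x=0}\frac{\partial}{\partial y}\!\left(\frac{b}{a}\right)\!(x,0)\,dx$. The coordinate-labelled envelope is the quotient map $q_I:(\mathbb C^J,0)\to(Q_I,o_I)$, $q_I^*X^\alpha=w^\alpha$, with the coordinates $w_j$ labelled; it amounts to the datum of $S_I\subset\mathbb N^J$. It "determines" a quantity if any two residual weight families $(\lambda_j)_{j\in J}\in(\mathbb C^* )^J$ with the same semigroup $S_I$ give the same value. For $I$ non-empty with independent support weights and $\alpha\in M_I$, the covector $\sum_{j\in J}\alpha_j\Lambda_j$ is uniquely $\sum_{i\in I}c_i(\alpha)\Lambda_i$; the logarithmic connection on $\mathcal O_{(\mathbb C^* )^I}\otimes\mathbb C[S_I]$ is $\nabla_I=d-\sum_{i\in I}\frac{dz_i}{z_i}\delta_i$ with $\delta_i(X^\alpha)=c_i(\alpha)X^\alpha$, and the monodromy around the $i$-th coordinate loop acts on $Q_I$ by $X^\alpha\mapsto e^{2\pi\sqrt{-1}\,c_i(\alpha)}X^\alpha$. *)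

theory Defs
  imports
    "HOL-Complex_Analysis.Complex_Analysis"
    "HOL-Probability.Probability"
    "HOL-Library.Poly_Mapping"
    "HOL-Library.Extended_Nat"
    "HOL-Algebra.Ideal"
begin

section \<open>Diagonal actions and their orbit foliations\<close>

text \<open>The Lie algebra is \<open>complex ^ 'k\<close>, and covectors are identified with row vectors.
  A family of \<open>n\<close> weights is the matrix \<open>L\<close> with rows \<open>L $ j\<close>, so that the value of the
  weight \<open>j\<close> at \<open>v\<close> is \<open>(L *v v) $ j\<close>.\<close>

definition act :: "complex ^ 'k ^ 'n \<Rightarrow> complex ^ 'k \<Rightarrow> complex ^ 'n \<Rightarrow> complex ^ 'n" where
  "act L t z = (\<chi> j. exp ((L *v t) $ j) * z $ j)"

definition fund_field :: "complex ^ 'k ^ 'n \<Rightarrow> complex ^ 'k \<Rightarrow> complex ^ 'n \<Rightarrow> complex ^ 'n" where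
  "fund_field L v z = (\<chi> j. (L *v v) $ j * z $ j)"

text \<open>Orbits are immersed, in general not embedded, so their dimension is the complex rank
  of the orbit map.\<close>

definition orbit_dim :: "complex ^ 'k ^ 'n \<Rightarrow> complex ^ 'n \<Rightarrow> nat" where
  "orbit_dim L z = vec.dim (range (frechet_derivative (\<lambda>t. act L t z) (at 0)))"

definition singular_locus :: "complex ^ 'k ^ 'n \<Rightarrow> (complex ^ 'n) set" where
  "singular_locus L = {z. orbit_dim L z < CARD('k)}"

definition poincare_domain :: "complex ^ 'k ^ 'n \<Rightarrow> bool" where
  "poincare_domain L \<longleftrightarrow> (\<exists>\<xi>. \<forall>j. 0 < Re ((L *v \<xi>) $ j))"

definition support :: "complex ^ 'n \<Rightarrow> 'n set" where
  "support z = {j. z $ j \<noteq> 0}"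

text \<open>\<open>coord_space A\<close> is the copy of \<open>\<complex>\<^sup>A\<close> inside the ambient space. Thus
  \<open>coord_space I\<close> is \<open>Z\<^sub>I\<close>, and \<open>p + coord_space (- I)\<close> is the
  transversal to it at a point \<open>p\<close> with support \<open>I\<close>.\<close>

definition coord_space :: "'n set \<Rightarrow> (complex ^ 'n) set" where
  "coord_space A = {z. \<forall>j. j \<notin> A \<longrightarrow> z $ j = 0}"

definition isotropy :: "complex ^ 'k ^ 'n \<Rightarrow> 'n set \<Rightarrow> (complex ^ 'k) set" where
  "isotropy L I = {v. \<forall>i\<in>I. (L *v v) $ i = 0}"

definition corank_one_support :: "complex ^ 'k ^ 'n \<Rightarrow> 'n set \<Rightarrow> bool" where
  "corank_one_support L I \<longleftrightarrow>
     vec.span (range (($) L)) = UNIV \<and>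
     card I + 1 = CARD('k) \<and>
     inj_on (($) L) I \<and> vec.independent (($) L ` I) \<and>
     (\<forall>j\<in>- I. \<exists>v\<in>isotropy L I. (L *v v) $ j \<noteq> 0)"


section \<open>Polynomials and irreducible components\<close>

text \<open>Polynomials in the variables \<open>'n\<close> are finitely supported maps on exponents.\<close>

type_synonym 'n cpoly = "('n \<Rightarrow>\<^sub>0 nat) \<Rightarrow>\<^sub>0 complex"

definition mpoly_eval :: "'n cpoly \<Rightarrow> ('n \<Rightarrow> complex) \<Rightarrow> complex" where
  "mpoly_eval p x =
     (\<Sum>m\<in>Poly_Mapping.keys p. Poly_Mapping.lookup p m *
        (\<Prod>j\<in>Poly_Mapping.keys m. x j ^ Poly_Mapping.lookup m j))"

definition zariski_closed :: "(complex ^ 'n) set \<Rightarrow> bool" where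
  "zariski_closed V \<longleftrightarrow> (\<exists>P. V = {z. \<forall>p\<in>P. mpoly_eval p (($) z) = 0})"

definition irreducible_closed :: "(complex ^ 'n) set \<Rightarrow> bool" where
  "irreducible_closed V \<longleftrightarrow>
     zariski_closed V \<and> V \<noteq> {} \<and>
     (\<forall>A B. zariski_closed A \<and> zariski_closed B \<and> V \<subseteq> A \<union> B \<longrightarrow> V \<subseteq> A \<or> V \<subseteq> B)"

definition irreducible_component :: "(complex ^ 'n) set \<Rightarrow> (complex ^ 'n) set \<Rightarrow> bool" where
  "irreducible_component V S \<longleftrightarrow>
     irreducible_closed V \<and> V \<subseteq> S \<and>
     (\<forall>W. irreducible_closed W \<and> V \<subseteq> W \<and> W \<subseteq> S \<longrightarrow> W = V)"

definition homogeneous_symmetric :: "'n set \<Rightarrow> nat \<Rightarrow> 'n cpoly \<Rightarrow> bool" where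
  "homogeneous_symmetric J d \<phi> \<longleftrightarrow>
     (\<forall>m\<in>Poly_Mapping.keys \<phi>.
        Poly_Mapping.keys m \<subseteq> J \<and> (\<Sum>j\<in>J. Poly_Mapping.lookup m j) = d) \<and>
     (\<forall>\<pi>. \<pi> permutes J \<longrightarrow>
        (\<forall>m. Poly_Mapping.lookup \<phi> (Poly_Mapping.map_key \<pi> m) = Poly_Mapping.lookup \<phi> m))"


section \<open>Residues of vector fields on \<open>\<complex>\<^sup>J\<close>\<close>

text \<open>Vector fields on \<open>\<complex>\<^sup>J\<close> are maps of the ambient space; only their values and
  \<open>J\<close>-components on \<open>coord_space J\<close> matter. Matrices indexed by \<open>J\<close> are functions of two
  indices, and their determinant is given by the Leibniz formula.\<close>

definition upd :: "complex ^ 'n \<Rightarrow> 'n \<Rightarrow> complex \<Rightarrow> complex ^ 'n" where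
  "upd w j t = (\<chi> i. if i = j then t else w $ i)"

definition jacobian :: "(complex ^ 'n \<Rightarrow> complex ^ 'n) \<Rightarrow> complex ^ 'n \<Rightarrow> 'n \<Rightarrow> 'n \<Rightarrow> complex" where
  "jacobian Y w i j = deriv (\<lambda>t. Y (upd w j t) $ i) (w $ j)"

definition det_on :: "'n set \<Rightarrow> ('n \<Rightarrow> 'n \<Rightarrow> 'a::comm_ring_1) \<Rightarrow> 'a" where
  "det_on J A = (\<Sum>\<pi> | \<pi> permutes J. of_int (sign \<pi>) * (\<Prod>i\<in>J. A i (\<pi> i)))"

definition charpoly_on :: "'n set \<Rightarrow> ('n \<Rightarrow> 'n \<Rightarrow> complex) \<Rightarrow> complex poly" where
  "charpoly_on J A = det_on J (\<lambda>i j. (if i = j then [:0, 1:] else 0) - [:A i j:])"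

text \<open>The value of a symmetric polynomial at a matrix is its value at the eigenvalues, counted
  with algebraic multiplicity; by symmetry the chosen enumeration of them is irrelevant.\<close>

definition matrix_eval :: "'n set \<Rightarrow> 'n cpoly \<Rightarrow> ('n \<Rightarrow> 'n \<Rightarrow> complex) \<Rightarrow> complex" where
  "matrix_eval J \<phi> A =
     mpoly_eval \<phi> (SOME ev. charpoly_on J A = (\<Prod>j\<in>J. [:- ev j, 1:]))"

text \<open>The Grothendieck residue at \<open>0\<close> of \<open>h dw\<close> with respect to \<open>f\<^sub>j\<close> (\<open>j \<in> J\<close>), where
  \<open>m = card J\<close>, is \<open>(2 \<pi> \<i>)\<^sup>-\<^sup>m\<close> times the integral of \<open>h dw / \<Prod>\<^sub>j f\<^sub>j\<close> over the cycle
  \<open>\<bar>f\<^sub>j\<bar> = \<epsilon>\<close> (\<open>j \<in> J\<close>) near \<open>0\<close>, oriented by the form \<open>d(arg f\<^sub>1) \<and> \<dots> \<and> d(arg f\<^sub>m)\<close>.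
  The map \<open>\<theta> = (arg f\<^sub>j)\<^sub>j\<close> makes this cycle an orientation preserving finite (branched)
  covering of the torus, and there \<open>dw / \<Prod>\<^sub>j f\<^sub>j = \<i>\<^sup>m (det Df)\<^sup>-\<^sup>1 d\<theta>\<close>. The integral
  is therefore the one over the torus, with respect to the normalised measure
  \<open>(2 \<pi>)\<^sup>-\<^sup>m d\<theta>\<close>, of the sum of \<open>h / det Df\<close> over the fibre.\<close>

definition residue_fibre ::
    "'n set \<Rightarrow> (complex ^ 'n \<Rightarrow> complex ^ 'n) \<Rightarrow> real \<Rightarrow> real \<Rightarrow> ('n \<Rightarrow> real) \<Rightarrow> (complex ^ 'n) set" where
  "residue_fibre J f r \<epsilon> \<theta> =
     {w \<in> coord_space J. norm w < r \<and> (\<forall>j\<in>J. f w $ j = of_real \<epsilon> * cis (\<theta> j))}"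

definition has_grothendieck_residue ::
    "'n set \<Rightarrow> (complex ^ 'n \<Rightarrow> complex) \<Rightarrow> (complex ^ 'n \<Rightarrow> complex ^ 'n) \<Rightarrow> complex \<Rightarrow> bool" where
  "has_grothendieck_residue J h f R \<longleftrightarrow>
     (\<forall>\<^sub>F r in at_right 0. \<forall>\<^sub>F \<epsilon> in at_right 0.
        has_bochner_integral (PiM J (\<lambda>_. uniform_measure lborel {0..2 * pi}))
          (\<lambda>\<theta>. \<Sum>w\<in>residue_fibre J f r \<epsilon> \<theta>. h w / det_on J (jacobian f w)) R)"

definition grothendieck_residue ::
    "'n set \<Rightarrow> (complex ^ 'n \<Rightarrow> complex) \<Rightarrow> (complex ^ 'n \<Rightarrow> complex ^ 'n) \<Rightarrow> complex" where
  "grothendieck_residue J h f = (THE R. has_grothendieck_residue J h f R)"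

definition baum_bott_residue ::
    "'n set \<Rightarrow> 'n cpoly \<Rightarrow> (complex ^ 'n \<Rightarrow> complex ^ 'n) \<Rightarrow> complex" where
  "baum_bott_residue J \<phi> Y =
     grothendieck_residue J (\<lambda>w. matrix_eval J \<phi> (jacobian Y w)) Y"

text \<open>The index at \<open>0\<close>, along the axis \<open>w\<^sub>b = 0\<close>, of the foliation generated by \<open>Y\<close> on the
  surface with coordinates \<open>x = w\<^sub>a\<close>, \<open>y = w\<^sub>b\<close>. It is meaningful if that axis is
  invariant.\<close>

definition axis_invariant :: "(complex ^ 'n \<Rightarrow> complex ^ 'n) \<Rightarrow> 'n \<Rightarrow> 'n \<Rightarrow> bool" where
  "axis_invariant Y a b \<longleftrightarrow> (\<forall>x. Y (axis a x) $ b = 0)"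

definition cs_index :: "(complex ^ 'n \<Rightarrow> complex ^ 'n) \<Rightarrow> 'n \<Rightarrow> 'n \<Rightarrow> complex" where
  "cs_index Y a b =
     residue (\<lambda>x. deriv (\<lambda>y. Y (axis a x + axis b y) $ b / Y (axis a x + axis b y) $ a) 0) 0"


section \<open>The residual transverse foliation\<close>

definition diag_field :: "'n set \<Rightarrow> ('n \<Rightarrow> complex) \<Rightarrow> complex ^ 'n \<Rightarrow> complex ^ 'n" where
  "diag_field J \<mu> w = (\<chi> j. if j \<in> J then \<mu> j * w $ j else 0)"

definition tangent_to_slice :: "complex ^ 'k ^ 'n \<Rightarrow> 'n set \<Rightarrow> complex ^ 'n \<Rightarrow> complex ^ 'k \<Rightarrow> bool" where
  "tangent_to_slice L I p v \<longleftrightarrow>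
     (\<forall>w\<in>coord_space (- I). fund_field L v (p + w) \<in> coord_space (- I))"

definition generates_transverse ::
    "complex ^ 'k ^ 'n \<Rightarrow> 'n set \<Rightarrow> complex ^ 'n \<Rightarrow> (complex ^ 'n \<Rightarrow> complex ^ 'n) \<Rightarrow> bool" where
  "generates_transverse L I p Y \<longleftrightarrow>
     (\<exists>v. tangent_to_slice L I p v \<and>
        (\<forall>w\<in>coord_space (- I). Y w = fund_field L v (p + w))) \<and>
     (\<forall>v. tangent_to_slice L I p v \<longrightarrow>
        (\<exists>c. \<forall>w\<in>coord_space (- I). fund_field L v (p + w) = c *s Y w))"

text \<open>The following two values are defined by localisation at a generic point \<open>p\<close> of \<open>Z\<^sub>I\<close>;
  they depend neither on \<open>p\<close> nor on the generator.\<close>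

definition baum_bott :: "'n cpoly \<Rightarrow> complex ^ 'k ^ 'n \<Rightarrow> 'n set \<Rightarrow> complex" where
  "baum_bott \<phi> L I =
     (THE R. \<forall>p Y. support p = I \<and> generates_transverse L I p Y \<longrightarrow>
        baum_bott_residue (- I) \<phi> Y = R)"

definition transverse_cs :: "complex ^ 'k ^ 'n \<Rightarrow> 'n set \<Rightarrow> 'n \<Rightarrow> 'n \<Rightarrow> complex" where
  "transverse_cs L I a b =
     (THE c. \<forall>p Y. support p = I \<and> generates_transverse L I p Y \<longrightarrow>
        axis_invariant Y a b \<and> cs_index Y a b = c)"


section \<open>The labelled envelope\<close>

definition residual_semigroup :: "'n set \<Rightarrow> ('n \<Rightarrow> complex) \<Rightarrow> ('n \<Rightarrow>\<^sub>0 nat) set" where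
  "residual_semigroup J \<mu> =
     {\<alpha>. Poly_Mapping.keys \<alpha> \<subseteq> J \<and> (\<Sum>j\<in>J. of_nat (Poly_Mapping.lookup \<alpha> j) * \<mu> j) = 0}"

definition resonance_semigroup :: "complex ^ 'k ^ 'n \<Rightarrow> 'n set \<Rightarrow> ('n \<Rightarrow>\<^sub>0 nat) set" where
  "resonance_semigroup L I =
     {\<alpha>. Poly_Mapping.keys \<alpha> \<subseteq> - I \<and>
        (\<forall>v\<in>isotropy L I. (\<Sum>j\<in>- I. of_nat (Poly_Mapping.lookup \<alpha> j) * (L *v v) $ j) = 0)}"

definition semigroup_algebra :: "('n \<Rightarrow>\<^sub>0 nat) set \<Rightarrow> 'n cpoly ring" where
  "semigroup_algebra S =
     \<lparr>carrier = {p. Poly_Mapping.keys p \<subseteq> S}, mult = (*), one = 1, zero = 0, add = (+)\<rparr>"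

definition spec_dim :: "('a, 'b) ring_scheme \<Rightarrow> enat" where
  "spec_dim R =
     (SUP l\<in>{l. \<exists>P. (\<forall>i\<le>l. primeideal (P i) R) \<and> (\<forall>i<l. P i \<subset> P (Suc i))}. enat l)"

definition envelope_dim :: "complex ^ 'k ^ 'n \<Rightarrow> 'n set \<Rightarrow> enat" where
  "envelope_dim L I = spec_dim (semigroup_algebra (resonance_semigroup L I))"

definition full_resonance_rank :: "complex ^ 'k ^ 'n \<Rightarrow> 'n set \<Rightarrow> bool" where
  "full_resonance_rank L I \<longleftrightarrow> envelope_dim L I = enat (CARD('n) - CARD('k))"

definition envelope_determines ::
    "'n set \<Rightarrow> ('n \<Rightarrow>\<^sub>0 nat) set \<Rightarrow> (('n \<Rightarrow> complex) \<Rightarrow> 'a) \<Rightarrow> bool" where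
  "envelope_determines J S Q \<longleftrightarrow>
     (\<forall>\<mu> \<mu>'. (\<forall>j\<in>J. \<mu> j \<noteq> 0 \<and> \<mu>' j \<noteq> 0) \<and>
        residual_semigroup J \<mu> = S \<and> residual_semigroup J \<mu>' = S \<longrightarrow> Q \<mu> = Q \<mu>')"


section \<open>The logarithmic connection\<close>

definition conn_coeff :: "complex ^ 'k ^ 'n \<Rightarrow> 'n set \<Rightarrow> ('n \<Rightarrow>\<^sub>0 nat) \<Rightarrow> 'n \<Rightarrow> complex" where
  "conn_coeff L I \<alpha> =
     (THE c. (\<forall>i. i \<notin> I \<longrightarrow> c i = 0) \<and>
        (\<Sum>j\<in>- I. of_nat (Poly_Mapping.lookup \<alpha> j) *s L $ j) = (\<Sum>i\<in>I. c i *s L $ i))"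

definition conn_delta :: "complex ^ 'k ^ 'n \<Rightarrow> 'n set \<Rightarrow> 'n \<Rightarrow> 'n cpoly \<Rightarrow> 'n cpoly" where
  "conn_delta L I i = Poly_Mapping.mapp (\<lambda>\<alpha> a. conn_coeff L I \<alpha> i * a)"

text \<open>The torus \<open>(\<complex>\<^sup>*)\<^sup>I\<close> is the stratum of points with support \<open>I\<close>. Continuous
  functions that are holomorphic in each variable are holomorphic (Osgood).\<close>

definition torus_holomorphic :: "'n set \<Rightarrow> (complex ^ 'n \<Rightarrow> complex) \<Rightarrow> bool" where
  "torus_holomorphic I f \<longleftrightarrow>
     continuous_on {z. support z = I} f \<and>
     (\<forall>z i. support z = I \<and> i \<in> I \<longrightarrow> (\<lambda>t. f (upd z i t)) field_differentiable at (z $ i))"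

definition conn_sections :: "'n set \<Rightarrow> ('n \<Rightarrow>\<^sub>0 nat) set \<Rightarrow> (complex ^ 'n \<Rightarrow> 'n cpoly) set" where
  "conn_sections I S =
     {s. (\<exists>F. finite F \<and> F \<subseteq> S \<and> (\<forall>z. support z = I \<longrightarrow> Poly_Mapping.keys (s z) \<subseteq> F)) \<and>
         (\<forall>\<alpha>. torus_holomorphic I (\<lambda>z. Poly_Mapping.lookup (s z) \<alpha>))}"

text \<open>\<open>log_connection L I s i z \<alpha>\<close> is the coefficient of \<open>X\<^sup>\<alpha>\<close> in the
  \<open>dz\<^sub>i\<close>-component of \<open>\<nabla>\<^sub>I s\<close> at \<open>z\<close>.\<close>

definition log_connection ::
    "complex ^ 'k ^ 'n \<Rightarrow> 'n set \<Rightarrow> (complex ^ 'n \<Rightarrow> 'n cpoly) \<Rightarrow> 'n \<Rightarrow> complex ^ 'n \<Rightarrow> ('n \<Rightarrow>\<^sub>0 nat) \<Rightarrow> complex" where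
  "log_connection L I =
     (\<lambda>s\<in>conn_sections I (resonance_semigroup L I). \<lambda>i\<in>I. \<lambda>z\<in>{z. support z = I}. \<lambda>\<alpha>.
        deriv (\<lambda>t. Poly_Mapping.lookup (s (upd z i t)) \<alpha>) (z $ i)
        - Poly_Mapping.lookup (conn_delta L I i (s z)) \<alpha> / z $ i)"

definition monodromy :: "complex ^ 'k ^ 'n \<Rightarrow> 'n set \<Rightarrow> 'n \<Rightarrow> 'n cpoly \<Rightarrow> 'n cpoly" where
  "monodromy L I =
     (\<lambda>i\<in>I. \<lambda>p\<in>carrier (semigroup_algebra (resonance_semigroup L I)).
        Poly_Mapping.mapp (\<lambda>\<alpha> a. exp (2 * of_real pi * \<i> * conn_coeff L I \<alpha> i) * a) p)"

end

theory Submission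
  imports Defs
begin

text \<open>
  The isotropy algebra of a corank-one support is a line, so every generator of the transverse
  foliation is a nonzero multiple of the diagonal field with eigenvalues \<open>\<lambda>\<^sub>j\<close>. On the fibres of the
  residue cycle the Baum--Bott integrand is then constant, and the factor drops out by homogeneity.

  That the envelope determines these numbers at full resonance rank rests on the bound
  \<open>dim \<complex>[S] \<le> card K\<close> whenever the coordinates in \<open>K\<close> separate the points of \<open>S\<close>: two
  non-proportional weight families with the same semigroup allow two coordinates to be
  eliminated, so the dimension falls below \<open>n - k\<close>. The bound itself follows by counting: more
  than \<open>card K\<close> elements of \<open>\<complex>[S]\<close> are algebraically dependent, whereas elements chosen
  successively in the steps of a chain of primes are independent. Below full rank with \<open>q = 1\<close> the
  semigroup is trivial, and all eigenvalue pairs \<open>(1, t)\<close> with \<open>t > 0\<close> share it.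
\<close>

section \<open>Krull dimension of semigroup algebras\<close>

text \<open>Dimension is measured by chains of primes in \<complex>[S], and S is given only as the
  solution set of a linear equation, with no generators at hand. The upper bound therefore works on
  a chain itself: the coordinates in K that separate S do for the counting what a transcendence
  basis would do. Two coordinates is the right number to eliminate because n - k is one less than
  card J; the elimination works because a second, non-proportional weight family gives a second
  linear equation for the difference of two elements of S. For q = 1 the dimension is 0 or 1: one
  nonzero resonance yields a nontrivial grading, hence a strict inclusion of two primes. The
  foliation invariants are definite descriptions ranging over all generic points and all generators.
  Independence of these choices is thus only half of the work; a point and a generator must also be
  exhibited, or the described value would not be unique. Over the trivial semigroup only the
  exponent 0 is left, and its connection coefficients vanish. This is why the connection and the
  monodromy cannot see the ratio of the residual weights.\<close>

lemma semigroup_algebra_simps [simp]: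
  "carrier (semigroup_algebra S) = {p. Poly_Mapping.keys p \<subseteq> S}"
  "x \<otimes>\<^bsub>semigroup_algebra S\<^esub> y = x * y"
  "x \<oplus>\<^bsub>semigroup_algebra S\<^esub> y = x + y"
  "\<one>\<^bsub>semigroup_algebra S\<^esub> = 1"
  "\<zero>\<^bsub>semigroup_algebra S\<^esub> = 0"
  by (simp_all add: semigroup_algebra_def)

lemma cring_semigroup_algebra:
  assumes "0 \<in> S" and "\<And>\<alpha> \<beta>. \<alpha> \<in> S \<Longrightarrow> \<beta> \<in> S \<Longrightarrow> \<alpha> + \<beta> \<in> S"
  shows "cring (semigroup_algebra S)"
proof -
  have mult: "Poly_Mapping.keys (p * q) \<subseteq> S"
    if "Poly_Mapping.keys p \<subseteq> S" "Poly_Mapping.keys q \<subseteq> S" for p q :: "'a cpoly"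
    using keys_mult[of p q] assms(2) that by blast
  have add: "Poly_Mapping.keys (p + q) \<subseteq> S"
    if "Poly_Mapping.keys p \<subseteq> S" "Poly_Mapping.keys q \<subseteq> S" for p q :: "'a cpoly"
    using Poly_Mapping.keys_add[of p q] that by blast
  show ?thesis
  proof (rule cringI)
    show "abelian_group (semigroup_algebra S)"
    proof (rule abelian_groupI; simp add: add ac_simps)
      fix p :: "'a cpoly"
      assume "Poly_Mapping.keys p \<subseteq> S"
      then show "\<exists>q. Poly_Mapping.keys q \<subseteq> S \<and> p + q = 0"
        by (intro exI[of _ "- p"]) (auto simp: in_keys_iff)
    qed
    show "Group.comm_monoid (semigroup_algebra S)"
      by (rule comm_monoidI) (auto simp: mult ac_simps assms(1) simp del: subsetI intro!: subsetD[OF mult])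
  qed (simp add: distrib_right)
qed

text \<open>\<open>Poly_Mapping.single 0 c\<close> is the constant polynomial c; multiplication by
  it serves as scalar multiplication below.\<close>

lemma lookup_single_zero_mult:
  "Poly_Mapping.lookup (Poly_Mapping.single 0 c * p) \<alpha> = c * Poly_Mapping.lookup p \<alpha>"
  for c :: "'b::semiring_0"
  by (simp add: mult_map_scale_conv_mult[symmetric] Poly_Mapping.map.rep_eq when_def)

text \<open>Gaussian elimination by induction on the equations: an equation that vanishes
  identically is dropped, any other one is used, with a pivot \<open>b0\<close>, to remove one
  unknown.\<close>

lemma linear_dependence:
  fixes v :: "'b \<Rightarrow> 't \<Rightarrow> 'a::field"
  assumes "finite T" "finite B" "card T < card B"
  shows "\<exists>c. (\<exists>b\<in>B. c b \<noteq> 0) \<and> (\<forall>t\<in>T. (\<Sum>b\<in>B. c b * v b t) = 0)"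
  using assms
proof (induction T arbitrary: B v rule: finite_induct)
  case empty
  then have "B \<noteq> {}" by auto
  then show ?case by (intro exI[of _ "\<lambda>_. 1"]) auto
next
  case (insert t T)
  show ?case
  proof (cases "\<forall>b\<in>B. v b t = 0")
    case True
    obtain c where "\<exists>b\<in>B. c b \<noteq> 0" "\<forall>s\<in>T. (\<Sum>b\<in>B. c b * v b s) = 0"
      using insert.IH[of B v] insert.prems insert.hyps by fastforce
    then show ?thesis using True by (intro exI[of _ c]) simp
  next
    case False
    then obtain b0 where b0: "b0 \<in> B" "v b0 t \<noteq> 0" by blast
    define w where "w b s = v b s - v b t / v b0 t * v b0 s" for b s
    have "card T < card (B - {b0})" "finite (B - {b0})"
      using insert.prems insert.hyps b0 by auto
    then obtain c where c: "\<exists>b\<in>B - {b0}. c b \<noteq> 0"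
        "\<forall>s\<in>T. (\<Sum>b\<in>B - {b0}. c b * w b s) = 0"
      using insert.IH[of "B - {b0}" w] by auto
    \<comment> \<open>The value at the pivot is the one that undoes the subtraction in
      \<open>w\<close>: the combination of \<open>v\<close> by \<open>d\<close> is that of
      \<open>w\<close> by \<open>c\<close>.\<close>
    define d where "d b = (if b = b0 then - (\<Sum>b\<in>B - {b0}. c b * (v b t / v b0 t)) else c b)" for b
    have d: "(\<Sum>b\<in>B. d b * v b s) = (\<Sum>b\<in>B - {b0}. c b * w b s)" for s
    proof -
      have "(\<Sum>b\<in>B. d b * v b s) = d b0 * v b0 s + (\<Sum>b\<in>B - {b0}. c b * v b s)"
        using b0 insert.prems(1) by (simp add: sum.remove d_def)
      also have "\<dots> = (\<Sum>b\<in>B - {b0}. c b * w b s)"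
        by (simp add: d_def w_def right_diff_distrib sum_subtractf sum_distrib_right mult.assoc)
      finally show ?thesis .
    qed
    have "w b t = 0" for b using b0 by (simp add: w_def)
    then have "\<forall>s\<in>insert t T. (\<Sum>b\<in>B. d b * v b s) = 0" using c d by simp
    moreover have "\<exists>b\<in>B. d b \<noteq> 0" using c(1) by (auto simp: d_def)
    ultimately show ?thesis by blast
  qed
qed

text \<open>Exponents are lists, so that an induction along a chain of primes strips an element
  together with its exponent. Since \<open>map2\<close> truncates, the lemmas carry equality of
  lengths.\<close>

definition monomial :: "'a::comm_monoid_mult list \<Rightarrow> nat list \<Rightarrow> 'a" where
  "monomial xs \<beta> = prod_list (map2 (^) xs \<beta>)"

lemma monomial_Cons [simp]: "monomial (x # xs) (b # \<beta>) = x ^ b * monomial xs \<beta>"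
  by (simp add: monomial_def)

lemma monomial_Nil [simp]: "monomial [] \<beta> = 1"
  by (simp add: monomial_def)

section \<open>Arithmetic modulo a prime ideal of the semigroup algebra\<close>

context
  fixes S :: "('n \<Rightarrow>\<^sub>0 nat) set" and P :: "'n cpoly set"
  assumes prime: "primeideal P (semigroup_algebra S)"
begin

interpretation primeideal P "semigroup_algebra S" by (rule prime)

lemma prime_keys: "p \<in> P \<Longrightarrow> Poly_Mapping.keys p \<subseteq> S"
  using a_subset by auto

text \<open>A prime ideal presupposes that \<open>semigroup_algebra S\<close> is a ring; its unit
  has the single key 0. The closure of S enters the following lemmas in the same way, through the
  ring structure.\<close>

lemma semigroup_zero: "0 \<in> S"
  using one_closed by simp

lemma prime_mult: "Poly_Mapping.keys r \<subseteq> S \<Longrightarrow> p \<in> P \<Longrightarrow> r * p \<in> P"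
  using I_l_closed by auto

lemma prime_zero: "0 \<in> P"
  using additive_subgroup.zero_closed[OF additive_subgroup_axioms] by simp

lemma prime_add: "p \<in> P \<Longrightarrow> q \<in> P \<Longrightarrow> p + q \<in> P"
  using additive_subgroup.a_closed[OF additive_subgroup_axioms] by simp

lemma prime_diff: "p - q \<in> P" if "p \<in> P" "q \<in> P"
proof -
  have "Poly_Mapping.single 0 (- 1) * q \<in> P"
    using that semigroup_zero by (intro prime_mult) auto
  from prime_add[OF that(1) this] show ?thesis
    by (simp add: single_uminus)
qed

lemma prime_sum: "(\<And>a. a \<in> A \<Longrightarrow> f a \<in> P) \<Longrightarrow> sum f A \<in> P"
  by (induction A rule: infinite_finite_induct) (auto intro: prime_add prime_zero)

lemma prime_prime:
  "Poly_Mapping.keys p \<subseteq> S \<Longrightarrow> Poly_Mapping.keys q \<subseteq> S \<Longrightarrow> p * q \<in> P \<Longrightarrow> p \<in> P \<or> q \<in> P"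
  using I_prime[of p q] by simp

lemma prime_one: "1 \<notin> P"
  using one_imp_carrier I_notcarr by auto

lemma prime_power: "Poly_Mapping.keys p \<subseteq> S \<Longrightarrow> p ^ m \<in> P \<Longrightarrow> p \<in> P"
proof (induction m)
  case (Suc m)
  have "p ^ m \<in> carrier (semigroup_algebra S)"
    by (induction m) (use Suc.prems(1) m_closed semigroup_zero in auto)
  then show ?case using Suc prime_prime[of p "p ^ m"] by auto
qed (use prime_one in auto)

lemma keys_mult_subset:
  "Poly_Mapping.keys p \<subseteq> S \<Longrightarrow> Poly_Mapping.keys q \<subseteq> S \<Longrightarrow> Poly_Mapping.keys (p * q) \<subseteq> S"
  for p q :: "'n cpoly"
  using m_closed[of p q] by simp

lemma keys_power_subset: "Poly_Mapping.keys p \<subseteq> S \<Longrightarrow> Poly_Mapping.keys (p ^ m) \<subseteq> S"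
  for p :: "'n cpoly"
  by (induction m) (use keys_mult_subset semigroup_zero in auto)

lemma keys_sum_subset: "(\<And>a. a \<in> A \<Longrightarrow> Poly_Mapping.keys (f a) \<subseteq> S) \<Longrightarrow> Poly_Mapping.keys (sum f A) \<subseteq> S"
  for f :: "'b \<Rightarrow> 'n cpoly"
  using keys_sum[of f A] by blast

lemma keys_monomial_subset:
  "\<forall>x\<in>set xs. Poly_Mapping.keys x \<subseteq> S \<Longrightarrow> length \<beta> = length xs \<Longrightarrow> Poly_Mapping.keys (monomial xs \<beta>) \<subseteq> S"
  for xs :: "'n cpoly list"
proof (induction xs arbitrary: \<beta>)
  case (Cons x xs)
  then obtain b \<beta>' where "\<beta> = b # \<beta>'" "length \<beta>' = length xs" by (auto simp: length_Suc_conv)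
  with Cons show ?case using keys_mult_subset[OF keys_power_subset[of x b]] by simp
qed (use semigroup_zero in auto)

end

text \<open>Dividing a relation by the largest power of the first element that divides every term puts the
  rest into \<open>P 0\<close>; modulo \<open>P 1\<close> only the terms free of the first element survive, a
  relation among the remaining elements.\<close>

lemma no_relation_along_prime_chain:
  fixes P :: "nat \<Rightarrow> 'n cpoly set"
  assumes "\<forall>i\<le>length xs. primeideal (P i) (semigroup_algebra S)"
    and "\<forall>i<length xs. P i \<subseteq> P (Suc i) \<and> xs ! i \<in> P (Suc i) - P i"
    and "finite B" "B \<noteq> {}" "\<forall>\<beta>\<in>B. length \<beta> = length xs \<and> c \<beta> \<noteq> 0"
    and "(\<Sum>\<beta>\<in>B. Poly_Mapping.single 0 (c \<beta>) * monomial xs \<beta>) \<in> P 0"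
  shows False
  using assms
proof (induction xs arbitrary: P B c)
  case Nil
  have P0: "primeideal (P 0) (semigroup_algebra S)" using Nil by simp
  \<comment> \<open>With no elements left, a relation is one nonzero constant, a unit inside a prime
    ideal.\<close>
  have B: "B = {[]}" using Nil by auto
  have "Poly_Mapping.single 0 (1 / c []) * Poly_Mapping.single 0 (c []) \<in> P 0"
    using Nil semigroup_zero[OF P0] by (intro prime_mult[OF P0]) (auto simp: B)
  then show False
    using Nil prime_one[OF P0] by (auto simp: B mult_single)
next
  case (Cons x xs)
  have P0: "primeideal (P 0) (semigroup_algebra S)" and P1: "primeideal (P 1) (semigroup_algebra S)"
    using Cons.prems(1) by auto
  have sub: "P 0 \<subseteq> P 1" and x: "x \<in> P 1" "x \<notin> P 0" using Cons.prems(2) by auto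
  have mem: "\<forall>y\<in>set (x # xs). Poly_Mapping.keys y \<subseteq> S"
  proof
    fix y assume "y \<in> set (x # xs)"
    then obtain i where "i < length (x # xs)" "y = (x # xs) ! i" by (metis in_set_conv_nth)
    then show "Poly_Mapping.keys y \<subseteq> S"
      using Cons.prems(1,2) prime_keys[of "P (Suc i)" S] by (metis DiffD1 Suc_leI)
  qed
  \<comment> \<open>The minimum is attained, so some term of the quotient is free of
    \<open>x\<close>; this keeps the relation handed to the induction hypothesis non-empty.\<close>
  define m where "m = Min (hd ` B)"
  have m: "m \<in> hd ` B" "\<And>\<beta>. \<beta> \<in> B \<Longrightarrow> m \<le> hd \<beta>"
    unfolding m_def using Cons.prems by auto
  define t where "t e \<beta> = Poly_Mapping.single 0 (c \<beta>) * (x ^ (hd \<beta> - e) * monomial xs (tl \<beta>))" for e \<beta>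
  have C: "Poly_Mapping.keys (Poly_Mapping.single (0::'n \<Rightarrow>\<^sub>0 nat) a) \<subseteq> S" for a :: complex
    using semigroup_zero[OF P0] by simp
  have mon: "Poly_Mapping.keys (monomial xs (tl \<beta>)) \<subseteq> S" if "\<beta> \<in> B" for \<beta>
    using mem Cons.prems(5) that by (intro keys_monomial_subset[OF P0]) auto
  have pow: "Poly_Mapping.keys (x ^ e) \<subseteq> S" for e
    using mem by (intro keys_power_subset[OF P0]) auto
  have tk: "Poly_Mapping.keys (t e \<beta>) \<subseteq> S" if "\<beta> \<in> B" for e \<beta>
    unfolding t_def by (intro keys_mult_subset[OF P0] C pow mon[OF that])
  have "(\<Sum>\<beta>\<in>B. Poly_Mapping.single 0 (c \<beta>) * monomial (x # xs) \<beta>) = x ^ m * (\<Sum>\<beta>\<in>B. t m \<beta>)"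
  proof -
    have "Poly_Mapping.single 0 (c \<beta>) * monomial (x # xs) \<beta> = x ^ m * t m \<beta>" if "\<beta> \<in> B" for \<beta>
    proof -
      have "length \<beta> = Suc (length xs)" using Cons.prems(5) that by simp
      then obtain b \<beta>' where \<beta>: "\<beta> = b # \<beta>'" by (cases \<beta>) auto
      have "x ^ b = x ^ m * x ^ (b - m)" using m(2)[OF that] \<beta> by (simp flip: power_add)
      then show ?thesis by (simp add: \<beta> t_def ac_simps)
    qed
    then show ?thesis by (simp add: sum_distrib_left)
  qed
  then have "x ^ m * (\<Sum>\<beta>\<in>B. t m \<beta>) \<in> P 0" using Cons.prems(6) by simp
  \<comment> \<open>Division by \<open>x ^ m\<close> is legitimate modulo the prime
    \<open>P 0\<close> because \<open>x\<close> lies outside it.\<close>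
  then have "(\<Sum>\<beta>\<in>B. t m \<beta>) \<in> P 0"
    using prime_prime[OF P0 pow[of m] keys_sum_subset[OF P0, of B "t m"]] tk
      prime_power[OF P0, of x m] x(2) mem by auto
  then have T: "(\<Sum>\<beta>\<in>B. t m \<beta>) \<in> P 1" using sub by blast
  define B1 where "B1 = {\<beta> \<in> B. hd \<beta> = m}"
  have "t m \<beta> \<in> P 1" if "\<beta> \<in> B - B1" for \<beta>
  proof -
    have "hd \<beta> - m \<noteq> 0" using m(2)[of \<beta>] that by (auto simp: B1_def)
    then obtain e where e: "hd \<beta> - m = Suc e" using not0_implies_Suc by blast
    have "t m \<beta> = (Poly_Mapping.single 0 (c \<beta>) * (x ^ e * monomial xs (tl \<beta>))) * x"
      by (simp add: t_def e ac_simps)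
    also have "\<dots> \<in> P 1"
      using that by (intro prime_mult[OF P1] x keys_mult_subset[OF P1] C pow mon) auto
    finally show ?thesis .
  qed
  then have "(\<Sum>\<beta>\<in>B - B1. t m \<beta>) \<in> P 1" by (rule prime_sum[OF P1])
  moreover have "(\<Sum>\<beta>\<in>B. t m \<beta>) = (\<Sum>\<beta>\<in>B - B1. t m \<beta>) + (\<Sum>\<beta>\<in>B1. t m \<beta>)"
    using Cons.prems(3) by (intro sum.subset_diff) (auto simp: B1_def)
  ultimately have G: "(\<Sum>\<beta>\<in>B1. t m \<beta>) \<in> P 1"
    using prime_diff[OF P1 T] by (metis add_diff_cancel_left')
  have B1: "\<beta> = m # tl \<beta>" if "\<beta> \<in> B1" for \<beta>
    using that Cons.prems(5) by (cases \<beta>) (auto simp: B1_def)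
  have inj: "inj_on tl B1" using B1 by (metis inj_onI)
  have "(\<Sum>\<beta>\<in>tl ` B1. Poly_Mapping.single 0 (c (m # \<beta>)) * monomial xs \<beta>) = (\<Sum>\<beta>\<in>B1. t m \<beta>)"
    unfolding sum.reindex[OF inj] o_def
    by (intro sum.cong) (auto simp: t_def B1[symmetric], auto simp: B1_def)
  then have *: "(\<Sum>\<beta>\<in>tl ` B1. Poly_Mapping.single 0 (c (m # \<beta>)) * monomial xs \<beta>) \<in> P (Suc 0)"
    using G by simp
  show False
  proof (rule Cons.IH[of "\<lambda>i. P (Suc i)" "tl ` B1" "\<lambda>\<beta>. c (m # \<beta>)", OF _ _ _ _ _ *])
    show "finite (tl ` B1)" using Cons.prems(3) by (simp add: B1_def)
    show "tl ` B1 \<noteq> {}" using m(1) by (auto simp: B1_def)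
    show "\<forall>\<beta>\<in>tl ` B1. length \<beta> = length xs \<and> c (m # \<beta>) \<noteq> 0"
      using B1 Cons.prems(5) by (auto simp: B1_def)
  qed (use Cons.prems(1,2) in auto)
qed

text \<open>The monomials with exponents at most \<open>N\<close> number \<open>(N + 1) ^ length xs\<close>, but they only involve
  \<open>O(N ^ card K)\<close> exponents of \<open>S\<close>.\<close>

lemma algebraic_relation_exists:
  fixes xs :: "'n cpoly list"
  assumes S: "0 \<in> S" "\<And>\<alpha> \<beta>. \<alpha> \<in> S \<Longrightarrow> \<beta> \<in> S \<Longrightarrow> \<alpha> + \<beta> \<in> S"
    and K: "finite K" "inj_on (\<lambda>\<alpha>. \<lambda>k\<in>K. Poly_Mapping.lookup \<alpha> k) S"
    and xs: "\<forall>x\<in>set xs. Poly_Mapping.keys x \<subseteq> S" "card K < length xs"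
  shows "\<exists>B c. finite B \<and> B \<noteq> {} \<and> (\<forall>\<beta>\<in>B. length \<beta> = length xs \<and> c \<beta> \<noteq> 0) \<and>
    (\<Sum>\<beta>\<in>B. Poly_Mapping.single 0 (c \<beta>) * monomial xs \<beta>) = 0"
proof -
  \<comment> \<open>Only the coordinates in \<open>K\<close> are bounded; as they separate S, a box
    is nevertheless finite. Bounds add up under multiplication.\<close>
  define box where "box M = {\<alpha> \<in> S. \<forall>k\<in>K. Poly_Mapping.lookup \<alpha> k \<le> M}" for M
  have box_add: "\<alpha> + \<beta> \<in> box (M + M')" if "\<alpha> \<in> box M" "\<beta> \<in> box M'" for \<alpha> \<beta> M M'
    using that S(2) by (fastforce simp: box_def lookup_add intro: add_mono)
  have box_mult: "Poly_Mapping.keys (p * q) \<subseteq> box (M + M')"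
    if "Poly_Mapping.keys p \<subseteq> box M" "Poly_Mapping.keys q \<subseteq> box M'" for p q :: "'n cpoly" and M M'
    using keys_mult[of p q] box_add that by blast
  have "\<exists>D. \<forall>x\<in>set xs. Poly_Mapping.keys x \<subseteq> box D"
  proof -
    define V where "V = (\<Union>x\<in>set xs. \<Union>\<alpha>\<in>Poly_Mapping.keys x. Poly_Mapping.lookup \<alpha> ` K)"
    have "finite V" using K(1) by (simp add: V_def)
    then have "\<forall>v\<in>V. v \<le> Max V" by simp
    then have "\<forall>x\<in>set xs. Poly_Mapping.keys x \<subseteq> box (Max V)"
      using xs(1) unfolding box_def V_def by blast
    then show ?thesis by blast
  qed
  then obtain D where D: "\<forall>x\<in>set xs. Poly_Mapping.keys x \<subseteq> box D" by blast
  have box0: "0 \<in> box 0" using S(1) by (simp add: box_def)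
  have box_power: "Poly_Mapping.keys (x ^ b) \<subseteq> box (D * b)" if "Poly_Mapping.keys x \<subseteq> box D" for x :: "'n cpoly" and b
    by (induction b) (use box0 box_mult[OF that] in auto)
  have box_monomial: "Poly_Mapping.keys (monomial ys \<beta>) \<subseteq> box (D * sum_list \<beta>)"
    if "\<forall>x\<in>set ys. Poly_Mapping.keys x \<subseteq> box D" "length \<beta> = length ys" for ys :: "'n cpoly list" and \<beta>
    using that
  proof (induction ys arbitrary: \<beta>)
    case Nil
    then show ?case using box0 by simp
  next
    case (Cons y ys)
    then obtain b \<beta>' where \<beta>: "\<beta> = b # \<beta>'" "length \<beta>' = length ys" by (auto simp: length_Suc_conv)
    show ?case
      using box_mult[OF box_power[of y b] Cons.IH[OF _ \<beta>(2)]] Cons.prems(1)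
      by (simp add: \<beta>(1) distrib_left)
  qed
  have card_box: "finite (box M) \<and> card (box M) \<le> (M + 1) ^ card K" for M
  proof -
    have "inj_on (\<lambda>\<alpha>. \<lambda>k\<in>K. Poly_Mapping.lookup \<alpha> k) (box M)"
      using K(2) by (rule inj_on_subset) (auto simp: box_def)
    moreover have "(\<lambda>\<alpha>. \<lambda>k\<in>K. Poly_Mapping.lookup \<alpha> k) ` box M \<subseteq> (K \<rightarrow>\<^sub>E {..M})"
      by (auto simp: box_def)
    moreover have "finite (K \<rightarrow>\<^sub>E {..M})" using K(1) by (intro finite_PiE) auto
    moreover have "card (K \<rightarrow>\<^sub>E {..M}) = (M + 1) ^ card K" using K(1) by (simp add: card_PiE)
    ultimately show ?thesis by (metis card_inj_on_le finite_imageD finite_subset)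
  qed
  \<comment> \<open>A monomial with all exponents at most \<open>N\<close> has its keys in
    \<open>box (E * N)\<close>. The value \<open>N = (E + 1) ^ card K\<close> makes the bound ((E +
    1) (N + 1)) ^ card K equal to N (N + 1) ^ card K, which is less than (N + 1) ^ (card K + 1) and
    so less than the number of exponent lists.\<close>
  define E where "E = D * length xs"
  define N where "N = (E + 1) ^ card K"
  define B0 where "B0 = {\<beta>. set \<beta> \<subseteq> {..N} \<and> length \<beta> = length xs}"
  have B0: "finite B0" "card B0 = (N + 1) ^ length xs"
    by (simp_all add: B0_def finite_lists_length_eq card_lists_length_eq)
  have "card (box (E * N)) \<le> (E * N + 1) ^ card K" using card_box by blast
  also have "\<dots> \<le> ((E + 1) * (N + 1)) ^ card K" by (intro power_mono) auto
  also have "\<dots> = N * (N + 1) ^ card K" by (simp only: N_def power_mult_distrib)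
  also have "\<dots> < (N + 1) * (N + 1) ^ card K" by simp
  also have "\<dots> \<le> (N + 1) ^ length xs"
    using xs(2) power_increasing[of "Suc (card K)" "length xs" "N + 1"] by simp
  finally have "card (box (E * N)) < card B0" by (simp add: B0)
  then obtain c where c: "\<exists>\<beta>\<in>B0. c \<beta> \<noteq> 0"
      "\<forall>\<alpha>\<in>box (E * N). (\<Sum>\<beta>\<in>B0. c \<beta> * Poly_Mapping.lookup (monomial xs \<beta>) \<alpha>) = 0"
    using linear_dependence[of "box (E * N)" B0 "\<lambda>\<beta>. Poly_Mapping.lookup (monomial xs \<beta>)"] B0(1) card_box
    by blast
  define B where "B = {\<beta> \<in> B0. c \<beta> \<noteq> 0}"
  have sum_zero: "(\<Sum>\<beta>\<in>B0. c \<beta> * Poly_Mapping.lookup (monomial xs \<beta>) \<alpha>) = 0" for \<alpha>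
  proof (cases "\<alpha> \<in> box (E * N)")
    case False
    have "Poly_Mapping.lookup (monomial xs \<beta>) \<alpha> = 0" if "\<beta> \<in> B0" for \<beta>
    proof -
      have len: "length \<beta> = length xs" and "\<forall>b\<in>set \<beta>. b \<le> N" using that by (auto simp: B0_def)
      from this(2) have "sum_list \<beta> \<le> length \<beta> * N" by (induction \<beta>) auto
      then have "D * sum_list \<beta> \<le> E * N" unfolding E_def len using mult_le_mono2 by (metis mult.assoc)
      then have "\<alpha> \<notin> box (D * sum_list \<beta>)" using False by (force simp: box_def)
      then show ?thesis using box_monomial[OF D len] by (meson in_keys_iff subsetD)
    qed
    then show ?thesis by simp
  qed (use c in blast)
  have "(\<Sum>\<beta>\<in>B. Poly_Mapping.single 0 (c \<beta>) * monomial xs \<beta>) = 0"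
  proof (rule poly_mapping_eqI)
    fix \<alpha>
    have "(\<Sum>\<beta>\<in>B. c \<beta> * Poly_Mapping.lookup (monomial xs \<beta>) \<alpha>)
        = (\<Sum>\<beta>\<in>B0. c \<beta> * Poly_Mapping.lookup (monomial xs \<beta>) \<alpha>)"
      using B0(1) by (intro sum.mono_neutral_left) (auto simp: B_def)
    then show "Poly_Mapping.lookup (\<Sum>\<beta>\<in>B. Poly_Mapping.single 0 (c \<beta>) * monomial xs \<beta>) \<alpha>
        = Poly_Mapping.lookup 0 \<alpha>"
      using sum_zero by (simp add: lookup_sum lookup_single_zero_mult)
  qed
  moreover have "finite B" using B0(1) by (simp add: B_def)
  moreover have "B \<noteq> {}" "\<forall>\<beta>\<in>B. length \<beta> = length xs \<and> c \<beta> \<noteq> 0"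
    using c(1) by (auto simp: B_def B0_def)
  ultimately show ?thesis by blast
qed

text \<open>This plays the role of the bound by transcendence degree. A longer chain would give
  elements that satisfy a relation by counting and none by the chain argument. It is applied with
  two coordinates removed from \<open>J\<close>, with a single coordinate, and with none at
  all.\<close>

lemma spec_dim_semigroup_algebra_le:
  fixes S :: "('n \<Rightarrow>\<^sub>0 nat) set"
  assumes S: "0 \<in> S" "\<And>\<alpha> \<beta>. \<alpha> \<in> S \<Longrightarrow> \<beta> \<in> S \<Longrightarrow> \<alpha> + \<beta> \<in> S"
    and K: "finite K" "inj_on (\<lambda>\<alpha>. \<lambda>k\<in>K. Poly_Mapping.lookup \<alpha> k) S"
  shows "spec_dim (semigroup_algebra S) \<le> enat (card K)"
  unfolding spec_dim_def
proof (rule SUP_least, clarify)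
  fix l P
  assume P: "\<forall>i\<le>l. primeideal (P i) (semigroup_algebra S)" "\<forall>i<l. P i \<subset> P (Suc i)"
  show "enat l \<le> enat (card K)"
  proof (rule ccontr)
    assume "\<not> enat l \<le> enat (card K)"
    then have l: "card K < l" by simp
    have "\<forall>i\<in>{..<l}. \<exists>x. x \<in> P (Suc i) - P i" using P(2) by blast
    then obtain x where x: "\<forall>i\<in>{..<l}. x i \<in> P (Suc i) - P i" by metis
    define xs where "xs = map x [0..<l]"
    have keys: "\<forall>y\<in>set xs. Poly_Mapping.keys y \<subseteq> S"
    proof
      fix y assume "y \<in> set xs"
      then obtain i where "i < l" "y = x i" by (auto simp: xs_def)
      then show "Poly_Mapping.keys y \<subseteq> S"
        using x P(1) prime_keys[of "P (Suc i)" S y] by auto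
    qed
    obtain B c where B: "finite B" "B \<noteq> {}" "\<forall>\<beta>\<in>B. length \<beta> = length xs \<and> c \<beta> \<noteq> 0"
        "(\<Sum>\<beta>\<in>B. Poly_Mapping.single 0 (c \<beta>) * monomial xs \<beta>) = 0"
      using algebraic_relation_exists[OF S K keys] l by (auto simp: xs_def)
    show False
      by (rule no_relation_along_prime_chain[of xs P S B c])
        (use P x B prime_zero[of "P 0" S] in \<open>auto simp: xs_def\<close>)
  qed
qed

section \<open>Gradings and the lower bound for the dimension\<close>

definition monomial_hom :: "('e \<Rightarrow> nat) \<Rightarrow> ('e \<Rightarrow>\<^sub>0 complex) \<Rightarrow> complex poly" where
  "monomial_hom d p = (\<Sum>\<alpha>\<in>Poly_Mapping.keys p. monom (Poly_Mapping.lookup p \<alpha>) (d \<alpha>))"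

text \<open>Keys may cancel in a sum of polynomials; summation over a common larger set of exponents
  makes additivity immediate.\<close>

lemma monomial_hom_superset:
  assumes "finite A" "Poly_Mapping.keys p \<subseteq> A"
  shows "monomial_hom d p = (\<Sum>\<alpha>\<in>A. monom (Poly_Mapping.lookup p \<alpha>) (d \<alpha>))"
  unfolding monomial_hom_def
  using assms by (intro sum.mono_neutral_left) (auto simp: in_keys_iff)

lemma monomial_hom_add: "monomial_hom d (p + q) = monomial_hom d p + monomial_hom d q"
proof -
  let ?A = "Poly_Mapping.keys p \<union> Poly_Mapping.keys q"
  have "monomial_hom d (p + q) = (\<Sum>\<alpha>\<in>?A. monom (Poly_Mapping.lookup (p + q) \<alpha>) (d \<alpha>))"
    using Poly_Mapping.keys_add[of p q] by (intro monomial_hom_superset) auto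
  also have "\<dots> = monomial_hom d p + monomial_hom d q"
    by (simp add: lookup_add add_monom[symmetric] sum.distrib monomial_hom_superset[of ?A])
  finally show ?thesis .
qed

lemma monomial_hom_zero [simp]: "monomial_hom d 0 = 0"
  by (simp add: monomial_hom_def)

lemma monomial_hom_single [simp]: "monomial_hom d (Poly_Mapping.single \<alpha> c) = monom c (d \<alpha>)"
  by (simp add: monomial_hom_def)

lemma poly_mapping_eq_sum_single:
  "p = (\<Sum>\<alpha>\<in>Poly_Mapping.keys p. Poly_Mapping.single \<alpha> (Poly_Mapping.lookup p \<alpha>))"
  by (rule poly_mapping_eqI)
    (auto simp: lookup_sum lookup_single when_def in_keys_iff)

lemma monomial_hom_mult:
  fixes d :: "'e::comm_monoid_add \<Rightarrow> nat"
  assumes d: "\<And>\<alpha> \<beta>. d (\<alpha> + \<beta>) = d \<alpha> + d \<beta>"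
  shows "monomial_hom d (p * q) = monomial_hom d p * monomial_hom d q"
proof -
  have sum: "monomial_hom d (sum f A) = (\<Sum>a\<in>A. monomial_hom d (f a))" for f :: "'b \<Rightarrow> 'e \<Rightarrow>\<^sub>0 complex" and A
    by (induction A rule: infinite_finite_induct) (simp_all add: monomial_hom_add)
  have "p * q = (\<Sum>\<alpha>\<in>Poly_Mapping.keys p. \<Sum>\<beta>\<in>Poly_Mapping.keys q.
      Poly_Mapping.single (\<alpha> + \<beta>) (Poly_Mapping.lookup p \<alpha> * Poly_Mapping.lookup q \<beta>))"
    by (subst poly_mapping_eq_sum_single[of p], subst poly_mapping_eq_sum_single[of q])
      (simp add: sum_product mult_single)
  then have "monomial_hom d (p * q) = (\<Sum>\<alpha>\<in>Poly_Mapping.keys p. \<Sum>\<beta>\<in>Poly_Mapping.keys q.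
      monom (Poly_Mapping.lookup p \<alpha>) (d \<alpha>) * monom (Poly_Mapping.lookup q \<beta>) (d \<beta>))"
    by (simp add: sum d mult_monom)
  then show ?thesis by (simp add: monomial_hom_def sum_product)
qed

text \<open>The target is a domain, so the kernel is prime, and it is proper because 1 is not sent
  to 0. The map lives on the whole polynomial ring and is cut down to \<complex>[S] only
  here.\<close>

lemma primeideal_kernel:
  fixes \<psi> :: "'n cpoly \<Rightarrow> 'd::idom"
  assumes cring: "cring (semigroup_algebra S)"
    and add: "\<And>p q. \<psi> (p + q) = \<psi> p + \<psi> q"
    and mult: "\<And>p q. \<psi> (p * q) = \<psi> p * \<psi> q"
    and one: "\<psi> 1 = 1"
  shows "primeideal {p. Poly_Mapping.keys p \<subseteq> S \<and> \<psi> p = 0} (semigroup_algebra S)"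
    (is "primeideal ?P ?R")
proof -
  have "\<psi> 0 + \<psi> 0 = \<psi> 0 + 0" using add[of 0 0] by (simp only: add_0_right)
  then have zero: "\<psi> 0 = 0" by (simp only: add_left_cancel)
  have neg: "\<psi> (- p) = - \<psi> p" for p using add[of p "- p"] zero by (simp add: eq_neg_iff_add_eq_0 add.commute)
  interpret cring "semigroup_algebra S" by (rule cring)
  have uminus: "\<ominus>\<^bsub>?R\<^esub> p = - p" if "Poly_Mapping.keys p \<subseteq> S" for p
  proof -
    have "Poly_Mapping.keys (- p) \<subseteq> S" using that by (auto simp: in_keys_iff)
    then show ?thesis using minus_equality[of "- p" p] that by simp
  qed
  show ?thesis
  proof (rule primeidealI2[OF _ cring])
    show "additive_subgroup ?P ?R"
    proof (rule additive_subgroup.intro, rule group.subgroupI)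
      show "Group.group (add_monoid ?R)" by (rule a_group)
      show "inv\<^bsub>add_monoid ?R\<^esub> p \<in> ?P" if "p \<in> ?P" for p
        using uminus[of p] that a_inv_closed[of p] by (auto simp: a_inv_def neg in_keys_iff)
      show "p \<otimes>\<^bsub>add_monoid ?R\<^esub> q \<in> ?P" if "p \<in> ?P" "q \<in> ?P" for p q
        using that Poly_Mapping.keys_add[of p q] by (auto simp: add)
    qed (auto simp: zero intro!: exI[of _ 0])
    show "carrier ?R \<noteq> ?P"
    proof -
      have "1 \<in> carrier ?R" using one_closed by simp
      moreover have "1 \<notin> ?P" using one by simp
      ultimately show ?thesis by blast
    qed
    show "p \<in> ?P \<or> q \<in> ?P" if "p \<in> carrier ?R" "q \<in> carrier ?R" "p \<otimes>\<^bsub>?R\<^esub> q \<in> ?P" for p q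
      using that by (auto simp: mult)
  qed (use m_closed in \<open>auto simp: mult\<close>)
qed

text \<open>The grading \<open>d\<close> maps \<open>\<complex>[S]\<close> to \<open>\<complex>[x]\<close>; the two primes are the preimages of
  \<open>(0)\<close> and \<open>(x)\<close>.\<close>

lemma spec_dim_semigroup_algebra_ge_one:
  fixes d :: "('n \<Rightarrow>\<^sub>0 nat) \<Rightarrow> nat"
  assumes S: "0 \<in> S" "\<And>\<alpha> \<beta>. \<alpha> \<in> S \<Longrightarrow> \<beta> \<in> S \<Longrightarrow> \<alpha> + \<beta> \<in> S"
    and d: "\<And>\<alpha> \<beta>. d (\<alpha> + \<beta>) = d \<alpha> + d \<beta>"
    and \<alpha>: "\<alpha> \<in> S" "d \<alpha> \<noteq> 0"
  shows "enat 1 \<le> spec_dim (semigroup_algebra S)"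
proof -
  have d0: "d 0 = 0" using d[of 0 0] by simp
  have one: "monomial_hom d 1 = 1"
    by (simp add: d0 flip: single_one)
  note cring = cring_semigroup_algebra[OF S]
  let ?P0 = "{p. Poly_Mapping.keys p \<subseteq> S \<and> monomial_hom d p = 0}"
  let ?P1 = "{p. Poly_Mapping.keys p \<subseteq> S \<and> poly (monomial_hom d p) 0 = 0}"
  have P0: "primeideal ?P0 (semigroup_algebra S)"
    by (rule primeideal_kernel[OF cring])
      (simp_all add: monomial_hom_add monomial_hom_mult[OF d] one)
  have P1: "primeideal ?P1 (semigroup_algebra S)"
    by (rule primeideal_kernel[OF cring])
      (simp_all add: monomial_hom_add monomial_hom_mult[OF d] one)
  \<comment> \<open>The image of this monomial is x to the power \<open>d \<alpha>\<close>: nonzero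
    as a polynomial, but zero at 0 since \<open>d \<alpha> \<noteq> 0\<close>.\<close>
  have "Poly_Mapping.single \<alpha> 1 \<in> ?P1 - ?P0"
    using \<alpha> by (simp add: poly_monom)
  then have "?P0 \<noteq> ?P1" by blast
  then have "?P0 \<subset> ?P1" by auto
  then have "(1::nat) \<in> {l. \<exists>P. (\<forall>i\<le>l. primeideal (P i) (semigroup_algebra S)) \<and> (\<forall>i<l. P i \<subset> P (Suc i))}"
    by (intro CollectI exI[of _ "\<lambda>i. if i = 0 then ?P0 else ?P1"]) (use P0 P1 \<open>?P0 \<subset> ?P1\<close> in auto)
  then show ?thesis unfolding spec_dim_def by (rule SUP_upper)
qed

section \<open>The singular locus\<close>

text \<open>The derivative of the orbit map at the identity is evaluation of the fundamental fields
  at \<open>z\<close>. Taken over the reals, it is in fact complex linear in \<open>v\<close>, so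
  \<open>orbit_dim\<close> becomes a complex rank.\<close>

lemma has_derivative_act: "((\<lambda>t. act L t z) has_derivative (\<lambda>v. fund_field L v z)) (at 0)"
proof -
  have comp: "((\<lambda>t. (L *v t) $ j) has_derivative (\<lambda>v. (L *v v) $ j)) (at 0)" for j
    by (intro bounded_linear_imp_has_derivative bounded_linear_compose[OF bounded_linear_vec_nth]
        matrix_vector_mul_bounded_linear)
  have deriv: "((\<lambda>t. exp ((L *v t) $ j) * z $ j) has_derivative (\<lambda>v. (L *v v) $ j * z $ j)) (at 0)" for j
  proof -
    have "((\<lambda>t. exp ((L *v t) $ j)) has_derivative (\<lambda>v. (L *v v) $ j * exp ((L *v 0) $ j))) (at 0)"
      by (rule has_derivative_compose[OF comp DERIV_exp[unfolded has_field_derivative_def], THEN has_derivative_eq_rhs])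
        (simp add: fun_eq_iff mult.commute)
    from has_derivative_mult_left[OF this, of "z $ j"] show ?thesis by simp
  qed
  show ?thesis
    unfolding has_derivative_def
  proof
    show "bounded_linear (\<lambda>v. fund_field L v z)"
      unfolding linear_conv_bounded_linear[symmetric]
    proof (rule linearI)
      show "fund_field L (r *\<^sub>R v) z = r *\<^sub>R fund_field L v z" for r v
        by (simp add: fund_field_def vec_eq_iff matrix_vector_mult_def flip: scaleR_sum_right)
    qed (simp add: fund_field_def vec_eq_iff matrix_vector_right_distrib distrib_right)
    show "((\<lambda>y. ((act L y z - act L (netlimit (at 0)) z) - fund_field L (y - netlimit (at 0)) z) /\<^sub>R
        norm (y - netlimit (at 0))) \<longlongrightarrow> 0) (at 0)"
      using deriv unfolding has_derivative_def
      by (intro vec_tendstoI) (simp add: act_def fund_field_def)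
  qed
qed

lemma orbit_dim_eq: "orbit_dim L z = vec.dim (range (\<lambda>v. fund_field L v z))"
  by (simp add: orbit_dim_def flip: frechet_derivative_at[OF has_derivative_act])

lemma linear_fund_field: "Vector_Spaces.linear (*s) (*s) (\<lambda>v. fund_field L v z)"
  by unfold_locales
    (simp_all add: fund_field_def vec_eq_iff matrix_vector_right_distrib matrix_vector_mult_scaleR
      vec.scale algebra_simps)

text \<open>The rank of the infinitesimal action at \<open>z\<close> drops exactly when it has a
  kernel, and the kernel is the isotropy algebra of the support of \<open>z\<close>.\<close>

lemma singular_locus_iff:
  "z \<in> singular_locus L \<longleftrightarrow> (\<exists>v\<in>isotropy L (support z). v \<noteq> 0)" (is "?l \<longleftrightarrow> ?r")
proof -
  let ?f = "\<lambda>v. fund_field L v z"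
  interpret f: Vector_Spaces.linear "(*s)" "(*s)" ?f by (rule linear_fund_field)
  have kernel: "?f v = 0 \<longleftrightarrow> v \<in> isotropy L (support z)" for v
    by (auto simp: fund_field_def isotropy_def support_def vec_eq_iff)
  have dim: "vec.dim (UNIV :: (complex ^ 'b) set) = CARD('b)"
    by (rule vec_dim_card)
  show ?thesis
  proof
    assume ?l
    then have *: "vec.dim (range ?f) < CARD('b)" by (simp add: singular_locus_def orbit_dim_eq)
    have "\<not> inj ?f"
    proof
      assume "inj ?f"
      then have "vec.dim (range ?f) = vec.dim (UNIV :: (complex ^ 'b) set)"
        by (intro vec.dim_image_eq[OF linear_fund_field]) (simp add: inj_on_subset)
      then show False using * dim by simp
    qed
    then show ?r using f.inj_iff_eq_0 kernel by blast
  next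
    assume ?r
    then obtain v where v: "?f v = 0" "v \<noteq> 0" using kernel by blast
    \<comment> \<open>In a basis through the kernel vector \<open>v\<close>, the image is spanned by
      the images of the other basis vectors, one fewer than the dimension.\<close>
    define B where "B = vec.extend_basis {v}"
    have "vec.independent {v}" using v(2) by simp
    then have B: "vec.independent B" "vec.span B = UNIV" "v \<in> B"
      unfolding B_def
      using vec.independent_extend_basis vec.span_extend_basis vec.extend_basis_superset by blast+
    have card: "finite B" "card B = CARD('b)"
      using vec.dim_eq_card[of B UNIV] B vec.finiteI_independent dim by auto
    have "range ?f = vec.span (?f ` B)"
      using f.span_image[of B] B(2) by simp
    also have "\<dots> = vec.span (insert 0 (?f ` (B - {v})))"
      using v(1) B(3) by (intro arg_cong[of _ _ vec.span]) (auto simp: image_iff)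
    finally have "range ?f = vec.span (?f ` (B - {v}))" by simp
    then have "vec.dim (range ?f) \<le> card (?f ` (B - {v}))"
      using card(1) by (simp add: vec.dim_le_card')
    also have "\<dots> \<le> card (B - {v})" using card(1) by (intro card_image_le) simp
    also have "\<dots> < CARD('b)" using card B(3) by (metis card_Diff1_less)
    finally show ?l by (simp add: singular_locus_def orbit_dim_eq)
  qed
qed

section \<open>The isotropy line of a corank-one support\<close>

lemma isotropy_antimono: "I \<subseteq> I' \<Longrightarrow> isotropy L I' \<subseteq> isotropy L I"
  by (auto simp: isotropy_def)

text \<open>Some \<open>u\<close> in the isotropy algebra is not killed by the weight
  \<open>j\<close>, so this weight is outside the span of the support weights. Together they are k
  independent covectors, a basis of the dual space, and only 0 is annihilated by a basis.\<close>

lemma corank_one_isotropy_eq_zero: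
  fixes L :: "complex ^ 'k ^ 'n"
  assumes L: "corank_one_support L I" and j: "j \<notin> I"
    and v: "v \<in> isotropy L I" "(L *v v) $ j = 0"
  shows "v = 0"
proof -
  \<comment> \<open>The covectors that vanish at \<open>u\<close>; the pairing is bilinear, without
    complex conjugation.\<close>
  define annihilated where "annihilated u = {r :: complex ^ 'k. (\<Sum>i\<in>UNIV. r $ i * u $ i) = 0}" for u
  have subspace: "vec.subspace (annihilated u)" for u
    by (rule vec.subspaceI)
      (simp_all add: annihilated_def distrib_right sum.distrib mult.assoc flip: sum_distrib_left)
  have mem: "L $ i \<in> annihilated u \<longleftrightarrow> (L *v u) $ i = 0" for i u
    by (simp add: annihilated_def matrix_vector_mult_def)
  from L j obtain u where u: "u \<in> isotropy L I" "(L *v u) $ j \<noteq> 0"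
    unfolding corank_one_support_def by blast
  have "($) L ` I \<subseteq> annihilated u" using u(1) mem by (auto simp: isotropy_def)
  then have "vec.span (($) L ` I) \<subseteq> annihilated u" using subspace by (rule vec.span_minimal)
  then have nspan: "L $ j \<notin> vec.span (($) L ` I)" using u(2) mem by blast
  have ind: "vec.independent (($) L ` I)" and inj: "inj_on (($) L) I" and card: "card I + 1 = CARD('k)"
    using L by (auto simp: corank_one_support_def)
  let ?B = "insert (L $ j) (($) L ` I)"
  have indB: "vec.independent ?B" using ind nspan by (rule vec.independent_insertI[rotated])
  have "L $ j \<notin> ($) L ` I" using nspan vec.span_base by blast
  then have cardB: "card ?B = CARD('k)" using inj card by (simp add: card_image)
  have "UNIV \<subseteq> vec.span ?B"
    by (rule vec.card_ge_dim_independent) (simp_all only: indB cardB vec_dim_card subset_UNIV order_refl not_False_eq_True)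
  moreover have "?B \<subseteq> annihilated v" using v mem by (auto simp: isotropy_def)
  then have "vec.span ?B \<subseteq> annihilated v" using subspace by (rule vec.span_minimal)
  ultimately have "axis i 1 \<in> annihilated v" for i by blast
  then have "v $ i = 0" for i
    by (simp add: annihilated_def axis_def if_distrib[of "\<lambda>x. x * _"] cong: if_cong)
  then show ?thesis by (simp add: vec_eq_iff)
qed

text \<open>Spanning weights number at least k, whereas \<open>I\<close> has only k - 1
  elements.\<close>

lemma corank_one_complement_nonempty:
  fixes L :: "complex ^ 'k ^ 'n"
  assumes "corank_one_support L I"
  shows "- I \<noteq> {}"
proof
  assume "- I = {}"
  then have "I = UNIV" by auto
  then have *: "vec.span (range (($) L)) = UNIV" "CARD('n) + 1 = CARD('k)"
    using assms by (auto simp: corank_one_support_def)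
  have "CARD('k) = vec.dim (range (($) L))"
    using *(1) vec_dim_card vec.dim_span by metis
  also have "\<dots> \<le> card (range (($) L))" by (rule vec.dim_le_card') simp
  also have "\<dots> \<le> CARD('n)" by (rule card_image_le) simp
  finally show False using *(2) by simp
qed

lemma corank_one_isotropy_nontrivial:
  assumes "corank_one_support L I"
  obtains v where "v \<in> isotropy L I" "v \<noteq> 0"
proof -
  obtain j where "j \<notin> I" using corank_one_complement_nonempty[OF assms] by blast
  then obtain v where "v \<in> isotropy L I" "(L *v v) $ j \<noteq> 0"
    using assms by (auto simp: corank_one_support_def)
  then show thesis by (intro that[of v]) auto
qed

lemma mult_vec_component: "(L *v (c *s v)) $ j = c * (L *v v) $ j"
  for L :: "'a::field ^ 'k ^ 'n"
  by (simp add: vec.scale)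

text \<open>Evaluation of one weight outside \<open>I\<close> is injective on the isotropy algebra;
  the factor is the ratio of its values at \<open>v\<close> and \<open>\<xi>\<close>.\<close>

lemma corank_one_isotropy_line:
  assumes L: "corank_one_support L I" and \<xi>: "\<xi> \<in> isotropy L I" "\<xi> \<noteq> 0" and v: "v \<in> isotropy L I"
  obtains c where "v = c *s \<xi>"
proof -
  obtain j where j: "j \<notin> I" using corank_one_complement_nonempty[OF L] by blast
  have \<xi>j: "(L *v \<xi>) $ j \<noteq> 0" using corank_one_isotropy_eq_zero[OF L j] \<xi> by blast
  define c where "c = (L *v v) $ j / (L *v \<xi>) $ j"
  have lin: "(L *v (v - c *s \<xi>)) $ i = (L *v v) $ i - c * (L *v \<xi>) $ i" for i
    by (simp add: matrix_vector_mult_diff_distrib mult_vec_component)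
  have "v - c *s \<xi> = 0"
  proof (rule corank_one_isotropy_eq_zero[OF L j])
    show "v - c *s \<xi> \<in> isotropy L I" using \<xi>(1) v by (simp add: isotropy_def lin)
    show "(L *v (v - c *s \<xi>)) $ j = 0" unfolding lin using \<xi>j by (simp add: c_def)
  qed
  then show thesis by (intro that[of c]) simp
qed

section \<open>Coordinate subspaces in the Zariski topology\<close>

lemma mpoly_eval_line:
  "\<exists>P. \<forall>t. mpoly_eval p (\<lambda>j. a j + t * d j) = poly P t"
  by (rule exI[of _ "\<Sum>m\<in>Poly_Mapping.keys p. [:Poly_Mapping.lookup p m:] *
      (\<Prod>j\<in>Poly_Mapping.keys m. [:a j, d j:] ^ Poly_Mapping.lookup m j)"])
    (simp add: mpoly_eval_def poly_sum poly_prod)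

lemma mpoly_eval_monomial:
  "mpoly_eval (Poly_Mapping.single m 1) x = (\<Prod>j\<in>Poly_Mapping.keys m. x j ^ Poly_Mapping.lookup m j)"
  by (simp add: mpoly_eval_def)

lemma zariski_closed_coord_space: "zariski_closed (coord_space A)"
  unfolding zariski_closed_def
  by (rule exI[of _ "(\<lambda>j. Poly_Mapping.single (Poly_Mapping.single j 1) 1) ` (- A)"])
    (auto simp: coord_space_def mpoly_eval_monomial)

text \<open>One equation suffices: the squarefree monomial with exponent \<open>m\<close>, the
  product of the coordinates in \<open>A\<close>.\<close>

lemma zariski_closed_hyperplanes:
  fixes A :: "'n::finite set"
  shows "zariski_closed {z :: complex ^ 'n. \<exists>j\<in>A. z $ j = 0}"
proof -
  define m where "m = (\<Sum>j\<in>A. Poly_Mapping.single j (1::nat))"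
  have lookup: "Poly_Mapping.lookup m j = (if j \<in> A then 1 else 0)" for j
    by (simp add: m_def lookup_sum lookup_single when_def)
  then have keys: "Poly_Mapping.keys m = A" by (auto simp: in_keys_iff split: if_splits)
  have "mpoly_eval (Poly_Mapping.single m 1) (($) z) = 0 \<longleftrightarrow> (\<exists>j\<in>A. z $ j = 0)" for z :: "complex ^ 'n"
    by (simp add: mpoly_eval_monomial keys lookup)
  then show ?thesis
    unfolding zariski_closed_def by (intro exI[of _ "{Poly_Mapping.single m 1}"]) simp
qed

text \<open>If neither closed set covered the subspace, a point \<open>b\<close> outside one and a
  point \<open>c\<close> outside the other would span a line in it. Along this line two one-variable
  polynomials have product zero, yet one is nonzero at \<open>t = 0\<close> and the other at
  \<open>t = 1\<close>.\<close>

lemma irreducible_closed_coord_space: "irreducible_closed (coord_space A)"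
  unfolding irreducible_closed_def
proof (intro conjI allI impI)
  show "coord_space A \<noteq> {}" by (auto simp: coord_space_def intro!: exI[of _ 0])
next
  fix B C :: "(complex ^ 'a) set"
  assume BC: "zariski_closed B \<and> zariski_closed C \<and> coord_space A \<subseteq> B \<union> C"
  then obtain P Q where P: "B = {z. \<forall>p\<in>P. mpoly_eval p (($) z) = 0}"
      and Q: "C = {z. \<forall>p\<in>Q. mpoly_eval p (($) z) = 0}"
    unfolding zariski_closed_def by blast
  show "coord_space A \<subseteq> B \<or> coord_space A \<subseteq> C"
  proof (rule ccontr)
    assume "\<not> ?thesis"
    then obtain b c where b: "b \<in> coord_space A" "b \<notin> B" and c: "c \<in> coord_space A" "c \<notin> C"
      by blast
    obtain p q where p: "p \<in> P" "mpoly_eval p (($) b) \<noteq> 0" and q: "q \<in> Q" "mpoly_eval q (($) c) \<noteq> 0"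
      using b c P Q by blast
    define z where "z t = b + t *s (c - b)" for t
    have z: "($) (z t) = (\<lambda>j. b $ j + t * (c $ j - b $ j))" for t
      by (simp add: z_def fun_eq_iff right_diff_distrib)
    obtain F where F: "\<And>t. mpoly_eval p (($) (z t)) = poly F t"
      using mpoly_eval_line[of p "($) b" "\<lambda>j. c $ j - b $ j"] unfolding z by blast
    obtain G where G: "\<And>t. mpoly_eval q (($) (z t)) = poly G t"
      using mpoly_eval_line[of q "($) b" "\<lambda>j. c $ j - b $ j"] unfolding z by blast
    have "z t \<in> coord_space A" for t using b c by (simp add: coord_space_def z_def)
    then have "z t \<in> B \<union> C" for t using BC by blast
    then have "poly (F * G) t = 0" for t using p(1) q(1) P Q by (auto simp flip: F G)
    then have "F * G = 0" using poly_all_0_iff_0 by blast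
    moreover have "poly F 0 \<noteq> 0" using p(2) F[of 0] by (simp add: z_def)
    moreover have "poly G 1 \<noteq> 0" using q(2) G[of 1] by (simp add: z_def)
    ultimately show False by auto
  qed
qed (rule zariski_closed_coord_space)

text \<open>Irreducibility splits off one hyperplane at a time; the empty union is excluded because
  irreducible closed sets are non-empty.\<close>

lemma irreducible_closed_subset_hyperplane:
  fixes A :: "'n::finite set"
  assumes V: "irreducible_closed V" and "V \<subseteq> {z. \<exists>j\<in>A. z $ j = 0}"
  shows "\<exists>j\<in>A. V \<subseteq> {z. z $ j = 0}"
  using finite[of A] assms(2)
proof (induction A rule: finite_induct)
  case empty
  then show ?case using V by (auto simp: irreducible_closed_def)
next
  case (insert j A)
  have "V \<subseteq> {z. z $ j = 0} \<union> {z. \<exists>j\<in>A. z $ j = 0}" using insert.prems by auto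
  moreover have "zariski_closed {z :: complex ^ 'n. z $ j = 0}"
    using zariski_closed_hyperplanes[of "{j}"] by simp
  ultimately have "V \<subseteq> {z. z $ j = 0} \<or> V \<subseteq> {z. \<exists>j\<in>A. z $ j = 0}"
    using V zariski_closed_hyperplanes[of A] unfolding irreducible_closed_def by blast
  then show ?case using insert.IH by blast
qed

text \<open>For maximality: an irreducible \<open>W\<close> properly containing Z_I lies in none of
  the hyperplanes \<open>z $ i = 0\<close> with \<open>i\<close> in \<open>insert j I\<close>, hence
  has a point where all these coordinates are nonzero. The isotropy algebra there is zero, so the
  point is not singular.\<close>

lemma coord_space_irreducible_component:
  fixes L :: "complex ^ 'k ^ 'n"
  assumes L: "corank_one_support L I"
  shows "irreducible_component (coord_space I) (singular_locus L)"
  unfolding irreducible_component_def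
proof (intro conjI allI impI)
  obtain v where v: "v \<in> isotropy L I" "v \<noteq> 0" by (rule corank_one_isotropy_nontrivial[OF L])
  show "coord_space I \<subseteq> singular_locus L"
  proof
    fix z :: "complex ^ 'n"
    assume "z \<in> coord_space I"
    then have "support z \<subseteq> I" by (auto simp: coord_space_def support_def)
    then show "z \<in> singular_locus L"
      using v isotropy_antimono unfolding singular_locus_iff by blast
  qed
next
  fix W
  assume W: "irreducible_closed W \<and> coord_space I \<subseteq> W \<and> W \<subseteq> singular_locus L"
  have "W \<subseteq> coord_space I"
  proof (rule ccontr)
    assume "\<not> W \<subseteq> coord_space I"
    then obtain w :: "complex ^ 'n" and j where w: "w \<in> W" "j \<notin> I" "w $ j \<noteq> 0" by (auto simp: coord_space_def)
    have "\<not> W \<subseteq> {z. z $ i = 0}" if "i \<in> insert j I" for i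
    proof (cases "i = j")
      case False
      have "(\<chi> i. if i \<in> I then 1 else 0) \<in> W" using W by (auto simp: coord_space_def)
      then show ?thesis using False that by auto
    qed (use w in auto)
    then have "\<not> W \<subseteq> {z. \<exists>i\<in>insert j I. z $ i = 0}"
      using irreducible_closed_subset_hyperplane[of W "insert j I"] W by blast
    then obtain z where z: "z \<in> W" "insert j I \<subseteq> support z" by (auto simp: support_def)
    then obtain v where v: "v \<in> isotropy L (support z)" "v \<noteq> 0"
      using W singular_locus_iff by blast
    then have "v \<in> isotropy L (insert j I)" using isotropy_antimono[OF z(2)] by blast
    then show False
      using corank_one_isotropy_eq_zero[OF L w(2), of v] v(2) by (simp add: isotropy_def)
  qed
  then show "W = coord_space I" using W by blast
qed (rule irreducible_closed_coord_space)

section \<open>Residues of diagonal vector fields\<close>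

lemma det_on_diagonal:
  fixes A :: "'n::finite \<Rightarrow> 'n \<Rightarrow> 'a::comm_ring_1"
  assumes "\<And>i j. i \<in> J \<Longrightarrow> j \<in> J \<Longrightarrow> i \<noteq> j \<Longrightarrow> A i j = 0"
  shows "det_on J A = (\<Prod>i\<in>J. A i i)"
proof -
  have "(\<Prod>i\<in>J. A i (\<pi> i)) = 0" if \<pi>: "\<pi> permutes J" "\<pi> \<noteq> id" for \<pi>
  proof -
    obtain i where "\<pi> i \<noteq> i" using \<pi>(2) by (auto simp: fun_eq_iff)
    then have i: "i \<in> J" "\<pi> i \<in> J" using \<pi>(1) permutes_in_image permutes_not_in by metis+
    then have "A i (\<pi> i) = 0" using assms \<open>\<pi> i \<noteq> i\<close> by metis
    then show ?thesis using i by (intro prod_zero) auto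
  qed
  then have "det_on J A = (\<Sum>\<pi>\<in>{id}. of_int (sign \<pi>) * (\<Prod>i\<in>J. A i (\<pi> i)))"
    unfolding det_on_def
    by (intro sum.mono_neutral_right) (auto simp: finite_permutations permutes_id)
  then show ?thesis by (simp add: sign_id)
qed

lemma mpoly_eval_homogeneous:
  fixes J :: "'n::finite set"
  assumes "homogeneous_symmetric J d \<phi>"
  shows "mpoly_eval \<phi> x =
    (\<Sum>m\<in>Poly_Mapping.keys \<phi>. Poly_Mapping.lookup \<phi> m * (\<Prod>j\<in>J. x j ^ Poly_Mapping.lookup m j))"
  unfolding mpoly_eval_def
proof (intro sum.cong refl arg_cong2[of _ _ _ _ "(*)"])
  fix m assume "m \<in> Poly_Mapping.keys \<phi>"
  then have "Poly_Mapping.keys m \<subseteq> J" using assms by (auto simp: homogeneous_symmetric_def)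
  then show "(\<Prod>j\<in>Poly_Mapping.keys m. x j ^ Poly_Mapping.lookup m j) = (\<Prod>j\<in>J. x j ^ Poly_Mapping.lookup m j)"
    by (intro prod.mono_neutral_left) (auto simp: in_keys_iff)
qed

text \<open>Besides absorbing a change of generator, the case \<open>c = 1\<close> says that only
  the values on \<open>J\<close> matter.\<close>

lemma mpoly_eval_scale:
  fixes J :: "'n::finite set"
  assumes \<phi>: "homogeneous_symmetric J d \<phi>" and "\<And>j. j \<in> J \<Longrightarrow> y j = c * x j"
  shows "mpoly_eval \<phi> y = c ^ d * mpoly_eval \<phi> x"
proof -
  have "(\<Prod>j\<in>J. y j ^ Poly_Mapping.lookup m j) = c ^ d * (\<Prod>j\<in>J. x j ^ Poly_Mapping.lookup m j)"
    if "m \<in> Poly_Mapping.keys \<phi>" for m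
  proof -
    have "(\<Sum>j\<in>J. Poly_Mapping.lookup m j) = d"
      using \<phi> that by (auto simp: homogeneous_symmetric_def)
    then have "(\<Prod>j\<in>J. c ^ Poly_Mapping.lookup m j) = c ^ d" by (simp flip: power_sum)
    then show ?thesis
      by (simp add: assms(2) power_mult_distrib prod.distrib)
  qed
  then show ?thesis
    by (simp add: mpoly_eval_homogeneous[OF \<phi>] sum_distrib_left mult.left_commute)
qed

text \<open>Symmetry is a condition on coefficients; reindexing the exponents and the factors by the
  same permutation carries it over to values. \<open>map_key\<close> has its intended meaning only
  for injective maps, hence the facts about \<open>\<pi>\<close> and its inverse.\<close>

lemma mpoly_eval_permute:
  fixes J :: "'n::finite set"
  assumes \<phi>: "homogeneous_symmetric J d \<phi>" and \<pi>: "\<pi> permutes J"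
  shows "mpoly_eval \<phi> (x \<circ> \<pi>) = mpoly_eval \<phi> x"
proof -
  define \<rho> where "\<rho> = inv_into UNIV \<pi>"
  have \<rho>: "\<rho> permutes J" "inj \<rho>" "inj \<pi>"
    unfolding \<rho>_def using \<pi> permutes_inv[OF \<pi>] by (blast intro: permutes_inj)+
  have inv: "\<pi> (\<rho> j) = j" "\<rho> (\<pi> j) = j" for j
    using \<pi> by (simp_all add: \<rho>_def permutes_inverses)
  have sym: "Poly_Mapping.lookup \<phi> (Poly_Mapping.map_key \<sigma> m) = Poly_Mapping.lookup \<phi> m"
    if "\<sigma> permutes J" for \<sigma> m
    using \<phi> that by (auto simp: homogeneous_symmetric_def)
  have [simp]: "Poly_Mapping.lookup (Poly_Mapping.map_key \<rho> m) j = Poly_Mapping.lookup m (\<rho> j)" for m j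
    by (simp add: Poly_Mapping.map_key.rep_eq[OF \<rho>(2)])
  have [simp]: "Poly_Mapping.lookup (Poly_Mapping.map_key \<pi> m) j = Poly_Mapping.lookup m (\<pi> j)" for m j
    by (simp add: Poly_Mapping.map_key.rep_eq[OF \<rho>(3)])
  have "mpoly_eval \<phi> x =
      (\<Sum>m\<in>Poly_Mapping.keys \<phi>. Poly_Mapping.lookup \<phi> m * (\<Prod>j\<in>J. (x \<circ> \<pi>) j ^ Poly_Mapping.lookup m j))"
    unfolding mpoly_eval_homogeneous[OF \<phi>]
  proof (rule sum.reindex_bij_witness[of _ "Poly_Mapping.map_key \<rho>" "Poly_Mapping.map_key \<pi>"])
    fix m
    have "(\<Prod>j\<in>J. x j ^ Poly_Mapping.lookup m j) = (\<Prod>j\<in>J. x (\<pi> j) ^ Poly_Mapping.lookup m (\<pi> j))"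
      using prod.permute[OF \<pi>, of "\<lambda>j. x j ^ Poly_Mapping.lookup m j"] by (simp add: o_def)
    then show "Poly_Mapping.lookup \<phi> (Poly_Mapping.map_key \<pi> m) *
          (\<Prod>j\<in>J. (x \<circ> \<pi>) j ^ Poly_Mapping.lookup (Poly_Mapping.map_key \<pi> m) j) =
        Poly_Mapping.lookup \<phi> m * (\<Prod>j\<in>J. x j ^ Poly_Mapping.lookup m j)"
      by (simp add: sym[OF \<pi>])
  qed (auto simp: in_keys_iff sym[OF \<pi>] sym[OF \<rho>(1)] inv intro!: poly_mapping_eqI)
  then show ?thesis by (simp add: mpoly_eval_homogeneous[OF \<phi>])
qed

text \<open>The enumeration picked by \<open>SOME\<close> need not be \<open>\<mu>\<close>. Both
  give the same characteristic polynomial, hence the same multiset of roots, so they differ by a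
  permutation of \<open>J\<close>, which symmetry absorbs.\<close>

lemma matrix_eval_diagonal:
  fixes J :: "'n::finite set"
  assumes \<phi>: "homogeneous_symmetric J d \<phi>"
    and A: "\<And>i j. i \<in> J \<Longrightarrow> j \<in> J \<Longrightarrow> A i j = (if i = j then \<mu> i else 0)"
  shows "matrix_eval J \<phi> A = mpoly_eval \<phi> \<mu>"
proof -
  have char: "charpoly_on J A = (\<Prod>j\<in>J. [:- \<mu> j, 1:])"
    unfolding charpoly_on_def by (subst det_on_diagonal) (auto simp: A)
  define ev where "ev = (SOME ev. charpoly_on J A = (\<Prod>j\<in>J. [:- ev j, 1:]))"
  have ev: "(\<Prod>j\<in>J. [:- \<mu> j, 1:]) = (\<Prod>j\<in>J. [:- ev j, 1:])"
    using someI[of "\<lambda>ev. charpoly_on J A = (\<Prod>j\<in>J. [:- ev j, 1:])", OF char] char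
    by (simp add: ev_def)
  have proots: "proots (\<Prod>j\<in>J. [:- f j, 1:]) = image_mset f (mset_set J)" for f :: "'n \<Rightarrow> complex"
  proof -
    have "proots (\<Prod>j\<in>J. [:- f j, 1:]) = (\<Sum>j\<in>J. {#f j#})"
      by (subst proots_prod) auto
    also have "\<dots> = image_mset f (mset_set J)"
      by (induction J rule: infinite_finite_induct) auto
    finally show ?thesis .
  qed
  have "image_mset \<mu> (mset_set J) = image_mset ev (mset_set J)"
    using arg_cong[OF ev, of proots] by (simp only: proots)
  then obtain \<pi> where \<pi>: "\<pi> permutes J" "\<forall>j\<in>J. \<mu> j = ev (\<pi> j)"
    by (rule image_mset_eq_implies_permutes[OF finite])
  have "mpoly_eval \<phi> \<mu> = mpoly_eval \<phi> (ev \<circ> \<pi>)"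
    using mpoly_eval_scale[OF \<phi>, of \<mu> 1 "ev \<circ> \<pi>"] \<pi>(2) by simp
  also have "\<dots> = mpoly_eval \<phi> ev" by (rule mpoly_eval_permute[OF \<phi> \<pi>(1)])
  finally show ?thesis by (simp add: matrix_eval_def ev_def)
qed

text \<open>A generator of the transverse foliation is prescribed only on the transversal and
  arbitrary elsewhere, so equality with a \<open>diag_field\<close> would be too strong.\<close>

definition diagonal_on :: "'n set \<Rightarrow> ('n \<Rightarrow> complex) \<Rightarrow> (complex ^ 'n \<Rightarrow> complex ^ 'n) \<Rightarrow> bool" where
  "diagonal_on J \<mu> Y \<longleftrightarrow> (\<forall>w\<in>coord_space J. \<forall>j\<in>J. Y w $ j = \<mu> j * w $ j)"

lemma diagonal_on_diag_field: "diagonal_on J \<mu> (diag_field J \<mu>)"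
  by (simp add: diagonal_on_def diag_field_def)

lemma jacobian_diagonal:
  assumes Y: "diagonal_on J \<mu> Y" and w: "w \<in> coord_space J" and "i \<in> J" "j \<in> J"
  shows "jacobian Y w i j = (if i = j then \<mu> i else 0)"
proof -
  have "Y (upd w j t) $ i = (if i = j then \<mu> i * t else \<mu> i * w $ i)" for t
  proof -
    have "upd w j t \<in> coord_space J" using w assms(4) by (auto simp: coord_space_def upd_def)
    then show ?thesis using Y assms(3) by (auto simp: diagonal_on_def upd_def)
  qed
  then have "jacobian Y w i j = deriv (\<lambda>t. if i = j then \<mu> i * t else \<mu> i * w $ i) (w $ j)"
    by (simp add: jacobian_def)
  also have "\<dots> = (if i = j then \<mu> i else 0)"
    by (auto intro!: DERIV_imp_deriv derivative_eq_intros)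
  finally show ?thesis .
qed

text \<open>The field is an invertible linear map of the transversal, so the cycle covers the torus
  with one sheet; smallness of \<epsilon> only keeps the unique preimage inside the ball.\<close>

lemma residue_fibre_diagonal:
  fixes J :: "'n::finite set"
  assumes Y: "diagonal_on J \<mu> Y" and \<mu>: "\<And>j. j \<in> J \<Longrightarrow> \<mu> j \<noteq> 0" and "r > 0"
  shows "\<forall>\<^sub>F \<epsilon> in at_right 0. \<forall>\<theta>. residue_fibre J Y r \<epsilon> \<theta> =
    {\<chi> j. if j \<in> J then of_real \<epsilon> * cis (\<theta> j) / \<mu> j else 0}"
proof -
  \<comment> \<open>The preimage has norm at most \<open>\<epsilon> * C\<close>, uniformly in
    \<theta>. The threshold uses \<open>C + 1\<close>, which is positive even if \<open>J\<close> is
    empty.\<close>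
  define C where "C = (\<Sum>j\<in>J. 1 / norm (\<mu> j))"
  have C: "C \<ge> 0" unfolding C_def by (intro sum_nonneg) auto
  have "residue_fibre J Y r \<epsilon> \<theta> = {\<chi> j. if j \<in> J then of_real \<epsilon> * cis (\<theta> j) / \<mu> j else 0}"
    (is "_ = {?w}") if \<epsilon>: "\<epsilon> > 0" "\<epsilon> < r / (C + 1)" for \<epsilon> \<theta>
  proof -
    have mem: "?w \<in> coord_space J" by (simp add: coord_space_def)
    have "norm ?w \<le> (\<Sum>j\<in>UNIV. norm (?w $ j))"
      unfolding norm_vec_def by (intro L2_set_le_sum) auto
    also have "\<dots> = (\<Sum>j\<in>J. norm (?w $ j))"
      by (intro sum.mono_neutral_right) auto
    also have "\<dots> = \<epsilon> * C"
      using \<epsilon>(1) by (simp add: C_def sum_distrib_left norm_divide norm_mult)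
    also have "\<dots> < r"
    proof -
      have "\<epsilon> * C \<le> \<epsilon> * (C + 1)" using \<epsilon>(1) by simp
      also have "\<dots> < r" using \<epsilon>(2) C by (simp add: pos_less_divide_eq)
      finally show ?thesis .
    qed
    finally have "norm ?w < r" .
    moreover have "w = ?w" if w: "w \<in> coord_space J" "\<forall>j\<in>J. Y w $ j = of_real \<epsilon> * cis (\<theta> j)" for w
    proof -
      have "w $ j = ?w $ j" for j
      proof (cases "j \<in> J")
        case True
        then have "\<mu> j * w $ j = of_real \<epsilon> * cis (\<theta> j)" using Y w by (auto simp: diagonal_on_def)
        then show ?thesis using True \<mu>[OF True] by (simp add: nonzero_eq_divide_eq mult.commute)
      qed (use w in \<open>simp add: coord_space_def\<close>)
      then show ?thesis unfolding vec_eq_iff by blast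
    qed
    moreover have "\<forall>j\<in>J. Y ?w $ j = of_real \<epsilon> * cis (\<theta> j)"
      using Y mem \<mu> unfolding diagonal_on_def by simp
    ultimately show ?thesis using mem unfolding residue_fibre_def by blast
  qed
  moreover have "r / (C + 1) > 0" using C \<open>r > 0\<close> by simp
  ultimately show ?thesis unfolding eventually_at_right_field by blast
qed

text \<open>One sheet and a constant Jacobian determinant make the integrand constant, and the
  normalised measure on the torus is a probability measure.\<close>

lemma has_grothendieck_residue_diagonal:
  fixes J :: "'n::finite set"
  assumes Y: "diagonal_on J \<mu> Y" and \<mu>: "\<And>j. j \<in> J \<Longrightarrow> \<mu> j \<noteq> 0"
    and h: "\<And>w. w \<in> coord_space J \<Longrightarrow> h w = c"
  shows "has_grothendieck_residue J h Y (c / (\<Prod>j\<in>J. \<mu> j))"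
proof -
  let ?T = "PiM J (\<lambda>_. uniform_measure lborel {0..2 * pi})"
  have "prob_space (uniform_measure lborel {0..2 * pi})"
    by (rule prob_space_uniform_measure) auto
  then interpret T: prob_space ?T by (intro prob_space_PiM)
  have const: "has_bochner_integral ?T (\<lambda>_. R) R" for R :: complex
    by (simp add: has_bochner_integral_iff T.prob_space)
  have "\<forall>\<^sub>F \<epsilon> in at_right 0. has_bochner_integral ?T
      (\<lambda>\<theta>. \<Sum>w\<in>residue_fibre J Y r \<epsilon> \<theta>. h w / det_on J (jacobian Y w)) (c / (\<Prod>j\<in>J. \<mu> j))"
    if "r > 0" for r
  proof -
    have "\<forall>\<^sub>F \<epsilon> in at_right 0. \<forall>\<theta>. residue_fibre J Y r \<epsilon> \<theta> =
        {\<chi> j. if j \<in> J then of_real \<epsilon> * cis (\<theta> j) / \<mu> j else 0}"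
      using Y \<mu> that by (rule residue_fibre_diagonal)
    then show ?thesis
    proof eventually_elim
      case (elim \<epsilon>)
      have "(\<Sum>w\<in>residue_fibre J Y r \<epsilon> \<theta>. h w / det_on J (jacobian Y w)) = c / (\<Prod>j\<in>J. \<mu> j)" for \<theta>
      proof -
        let ?w = "\<chi> j. if j \<in> J then of_real \<epsilon> * cis (\<theta> j) / \<mu> j else 0"
        have mem: "?w \<in> coord_space J" by (simp add: coord_space_def)
        then have "det_on J (jacobian Y ?w) = (\<Prod>j\<in>J. \<mu> j)"
          by (subst det_on_diagonal) (simp_all add: jacobian_diagonal[OF Y])
        then show ?thesis using elim h[OF mem] by simp
      qed
      then show ?case using const by simp
    qed
  qed
  then show ?thesis
    unfolding has_grothendieck_residue_def by (auto simp: eventually_at_right_field intro: exI[of _ 1])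
qed

text \<open>\<open>at_right 0\<close> is a proper filter, so some radius and some \<epsilon> serve
  both values, and these are then integrals of the same function.\<close>

lemma has_grothendieck_residue_unique:
  assumes "has_grothendieck_residue J h f R" "has_grothendieck_residue J h f R'"
  shows "R = R'"
proof -
  let ?i = "\<lambda>r \<epsilon>. has_bochner_integral (PiM J (\<lambda>_. uniform_measure lborel {0..2 * pi}))
    (\<lambda>\<theta>. \<Sum>w\<in>residue_fibre J f r \<epsilon> \<theta>. h w / det_on J (jacobian f w))"
  have "\<forall>\<^sub>F r in at_right 0. (\<forall>\<^sub>F \<epsilon> in at_right 0. ?i r \<epsilon> R) \<and> (\<forall>\<^sub>F \<epsilon> in at_right 0. ?i r \<epsilon> R')"
    using assms unfolding has_grothendieck_residue_def by (rule eventually_conj)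
  then obtain r where "\<forall>\<^sub>F \<epsilon> in at_right 0. ?i r \<epsilon> R" "\<forall>\<^sub>F \<epsilon> in at_right 0. ?i r \<epsilon> R'"
    using eventually_happens'[of "at_right (0::real)"] by force
  then have "\<forall>\<^sub>F \<epsilon> in at_right 0. ?i r \<epsilon> R \<and> ?i r \<epsilon> R'" by (rule eventually_conj)
  then obtain \<epsilon> where "?i r \<epsilon> R" "?i r \<epsilon> R'"
    using eventually_happens'[of "at_right (0::real)"] by force
  then show ?thesis by (rule has_bochner_integral_eq)
qed

lemma baum_bott_residue_diagonal:
  fixes J :: "'n::finite set"
  assumes "homogeneous_symmetric J d \<phi>" and Y: "diagonal_on J \<mu> Y" and "\<And>j. j \<in> J \<Longrightarrow> \<mu> j \<noteq> 0"
  shows "baum_bott_residue J \<phi> Y = mpoly_eval \<phi> \<mu> / (\<Prod>j\<in>J. \<mu> j)"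
  unfolding baum_bott_residue_def grothendieck_residue_def
proof (rule the_equality)
  show *: "has_grothendieck_residue J (\<lambda>w. matrix_eval J \<phi> (jacobian Y w)) Y (mpoly_eval \<phi> \<mu> / (\<Prod>j\<in>J. \<mu> j))"
    using assms(1,3) jacobian_diagonal[OF Y]
    by (intro has_grothendieck_residue_diagonal[OF Y] matrix_eval_diagonal)
  show "R = mpoly_eval \<phi> \<mu> / (\<Prod>j\<in>J. \<mu> j)"
    if "has_grothendieck_residue J (\<lambda>w. matrix_eval J \<phi> (jacobian Y w)) Y R" for R
    using that * by (rule has_grothendieck_residue_unique)
qed

lemma axis_invariant_diagonal:
  assumes Y: "diagonal_on J \<mu> Y" and "a \<in> J" "b \<in> J" "a \<noteq> b"
  shows "axis_invariant Y a b"
proof -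
  have "axis a x \<in> coord_space J" for x :: complex
    using assms(2) by (auto simp: coord_space_def axis_def)
  then show ?thesis
    using Y assms(3,4) by (auto simp: axis_invariant_def diagonal_on_def axis_def)
qed

lemma cs_index_diagonal:
  assumes Y: "diagonal_on J \<mu> Y" and ab: "a \<in> J" "b \<in> J" "a \<noteq> b"
  shows "cs_index Y a b = \<mu> b / \<mu> a"
proof -
  \<comment> \<open>This also holds for \<open>x = 0\<close> and for \<open>\<mu> a = 0\<close>,
    where both sides are 0 by the convention on division.\<close>
  have "Y (axis a x + axis b y) $ b / Y (axis a x + axis b y) $ a = \<mu> b / \<mu> a / x * y" for x y
  proof -
    have "axis a x + axis b y \<in> coord_space J"
      using ab by (auto simp: coord_space_def axis_def)
    then show ?thesis using Y ab by (simp add: diagonal_on_def axis_def)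
  qed
  moreover have "deriv (\<lambda>y. k * y) 0 = k" for k :: complex
    by (rule DERIV_imp_deriv) (auto intro!: derivative_eq_intros)
  ultimately have "cs_index Y a b = residue (\<lambda>x. \<mu> b / \<mu> a / (x - 0)) 0"
    by (simp only: cs_index_def diff_zero)
  also have "\<dots> = \<mu> b / \<mu> a"
    by (rule residue_simple[of UNIV 0 "\<lambda>_. \<mu> b / \<mu> a"]) auto
  finally show ?thesis .
qed

section \<open>The transverse foliation\<close>

text \<open>The point \<open>w = 0\<close> decides: there the components in \<open>I\<close> are the
  weights times nonzero coordinates of \<open>p\<close>.\<close>

lemma tangent_to_slice_iff:
  assumes p: "support p = I"
  shows "tangent_to_slice L I p v \<longleftrightarrow> v \<in> isotropy L I"
proof
  assume "tangent_to_slice L I p v"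
  moreover have "0 \<in> coord_space (- I)" by (simp add: coord_space_def)
  ultimately have "fund_field L v (p + 0) \<in> coord_space (- I)"
    unfolding tangent_to_slice_def by blast
  then show "v \<in> isotropy L I"
    using p by (auto simp: coord_space_def fund_field_def isotropy_def support_def)
qed (auto simp: tangent_to_slice_def coord_space_def fund_field_def isotropy_def)

lemma fund_field_slice:
  assumes p: "support p = I" and v: "v \<in> isotropy L I"
  shows "fund_field L v (p + w) = diag_field (- I) (($) (L *v v)) w"
  using assms by (auto simp: fund_field_def diag_field_def vec_eq_iff isotropy_def support_def)

context
  fixes L :: "complex ^ 'k::finite ^ 'n::finite" and I \<xi>
  assumes L: "corank_one_support L I" and \<xi>: "\<xi> \<in> isotropy L I" "\<xi> \<noteq> 0"
begin

lemma residual_weight_nonzero: "j \<in> - I \<Longrightarrow> (L *v \<xi>) $ j \<noteq> 0"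
  using corank_one_isotropy_eq_zero[OF L, of j \<xi>] \<xi> by blast

lemma generates_transverse_diag_field:
  assumes p: "support p = I"
  shows "generates_transverse L I p (diag_field (- I) (($) (L *v \<xi>)))"
  unfolding generates_transverse_def tangent_to_slice_iff[OF p]
proof (intro conjI allI impI)
  show "\<exists>v. v \<in> isotropy L I \<and>
      (\<forall>w\<in>coord_space (- I). diag_field (- I) (($) (L *v \<xi>)) w = fund_field L v (p + w))"
    using \<xi>(1) fund_field_slice[OF p] by metis
next
  fix v assume v: "v \<in> isotropy L I"
  then obtain c where c: "v = c *s \<xi>" by (rule corank_one_isotropy_line[OF L \<xi>])
  have "fund_field L v (p + w) = c *s diag_field (- I) (($) (L *v \<xi>)) w" for w
    by (subst fund_field_slice[OF p v]) (simp add: c mult_vec_component diag_field_def vec_eq_iff)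
  then show "\<exists>c. \<forall>w\<in>coord_space (- I). fund_field L v (p + w) = c *s diag_field (- I) (($) (L *v \<xi>)) w"
    by blast
qed

text \<open>The first clause of \<open>generates_transverse\<close> yields the factor
  \<open>c\<close>; the second, applied to \<open>\<xi>\<close> itself, shows that it is
  nonzero.\<close>

lemma generates_transverse_diagonal:
  assumes p: "support p = I" and Y: "generates_transverse L I p Y"
  obtains c where "c \<noteq> 0" "diagonal_on (- I) (\<lambda>j. c * (L *v \<xi>) $ j) Y"
proof -
  obtain v where v: "v \<in> isotropy L I" and Yv: "\<forall>w\<in>coord_space (- I). Y w = fund_field L v (p + w)"
    using Y unfolding generates_transverse_def tangent_to_slice_iff[OF p] by blast
  obtain c where c: "v = c *s \<xi>" using v by (rule corank_one_isotropy_line[OF L \<xi>])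
  have Yw: "Y w $ j = c * (L *v \<xi>) $ j * w $ j" if "w \<in> coord_space (- I)" "j \<in> - I" for w j
  proof -
    have "Y w $ j = (L *v v) $ j * w $ j"
      using that Yv by (simp add: fund_field_slice[OF p v] diag_field_def)
    then show ?thesis by (simp add: c mult_vec_component)
  qed
  obtain c' where c': "\<forall>w\<in>coord_space (- I). fund_field L \<xi> (p + w) = c' *s Y w"
    using Y \<xi>(1) unfolding generates_transverse_def tangent_to_slice_iff[OF p] by blast
  obtain j where j: "j \<in> - I" using corank_one_complement_nonempty[OF L] by blast
  have mem: "axis j 1 \<in> coord_space (- I)" using j by (auto simp: coord_space_def axis_def)
  have "fund_field L \<xi> (p + axis j 1) $ j = (L *v \<xi>) $ j"
    using j by (simp add: fund_field_slice[OF p \<xi>(1)] diag_field_def)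
  then have "c' * (c * (L *v \<xi>) $ j) = (L *v \<xi>) $ j"
    using c' mem Yw[OF mem j] by simp
  then have "c \<noteq> 0" using residual_weight_nonzero[OF j] by auto
  moreover have "diagonal_on (- I) (\<lambda>j. c * (L *v \<xi>) $ j) Y"
    using Yw by (simp add: diagonal_on_def)
  ultimately show thesis by (rule that)
qed

lemma support_point_exists: "\<exists>p :: complex ^ 'n. support p = I"
  by (rule exI[of _ "\<chi> i. if i \<in> I then 1 else 0"]) (auto simp: support_def)

text \<open>The degree of \<open>\<phi>\<close> equals the number of residual weights, so the factor
  of another generator enters numerator and denominator with the same power.\<close>

lemma baum_bott_eq:
  assumes \<phi>: "homogeneous_symmetric (- I) (card (- I)) \<phi>"
  shows "baum_bott \<phi> L I = mpoly_eval \<phi> (($) (L *v \<xi>)) / (\<Prod>j\<in>- I. (L *v \<xi>) $ j)"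
  unfolding baum_bott_def
proof (rule the_equality)
  let ?R = "mpoly_eval \<phi> (($) (L *v \<xi>)) / (\<Prod>j\<in>- I. (L *v \<xi>) $ j)"
  show *: "\<forall>p Y. support p = I \<and> generates_transverse L I p Y \<longrightarrow> baum_bott_residue (- I) \<phi> Y = ?R"
  proof (intro allI impI)
    fix p Y assume "support p = I \<and> generates_transverse L I p Y"
    then obtain c where c: "c \<noteq> 0" "diagonal_on (- I) (\<lambda>j. c * (L *v \<xi>) $ j) Y"
      using generates_transverse_diagonal by blast
    have "baum_bott_residue (- I) \<phi> Y
        = mpoly_eval \<phi> (\<lambda>j. c * (L *v \<xi>) $ j) / (\<Prod>j\<in>- I. c * (L *v \<xi>) $ j)"
      using c residual_weight_nonzero by (intro baum_bott_residue_diagonal[OF \<phi>]) auto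
    also have "\<dots> = ?R"
      using c(1) by (simp add: mpoly_eval_scale[OF \<phi>, of _ c "($) (L *v \<xi>)"] prod.distrib)
    finally show "baum_bott_residue (- I) \<phi> Y = ?R" .
  qed
  fix R assume "\<forall>p Y. support p = I \<and> generates_transverse L I p Y \<longrightarrow> baum_bott_residue (- I) \<phi> Y = R"
  then show "R = ?R"
    using * support_point_exists generates_transverse_diag_field by blast
qed

lemma transverse_cs_eq:
  assumes ab: "a \<in> - I" "b \<in> - I" "a \<noteq> b"
  shows "transverse_cs L I a b = (L *v \<xi>) $ b / (L *v \<xi>) $ a"
  unfolding transverse_cs_def
proof (rule the_equality)
  let ?R = "(L *v \<xi>) $ b / (L *v \<xi>) $ a"
  show *: "\<forall>p Y. support p = I \<and> generates_transverse L I p Y \<longrightarrow>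
      axis_invariant Y a b \<and> cs_index Y a b = ?R"
  proof (intro allI impI)
    fix p Y assume "support p = I \<and> generates_transverse L I p Y"
    then obtain c where c: "c \<noteq> 0" "diagonal_on (- I) (\<lambda>j. c * (L *v \<xi>) $ j) Y"
      using generates_transverse_diagonal by blast
    then show "axis_invariant Y a b \<and> cs_index Y a b = ?R"
      using axis_invariant_diagonal[OF c(2) ab] cs_index_diagonal[OF c(2) ab] by simp
  qed
  fix R assume "\<forall>p Y. support p = I \<and> generates_transverse L I p Y \<longrightarrow>
      axis_invariant Y a b \<and> cs_index Y a b = R"
  then show "R = ?R"
    using * support_point_exists generates_transverse_diag_field by blast
qed

text \<open>A relation on a line is tested at one nonzero vector. This links the action to the
  weight families over which \<open>envelope_determines\<close> quantifies.\<close>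

lemma resonance_semigroup_eq_residual:
  "resonance_semigroup L I = residual_semigroup (- I) (($) (L *v \<xi>))"
proof -
  have "(\<forall>v\<in>isotropy L I. (\<Sum>j\<in>- I. of_nat (Poly_Mapping.lookup \<alpha> j) * (L *v v) $ j) = 0) \<longleftrightarrow>
      (\<Sum>j\<in>- I. of_nat (Poly_Mapping.lookup \<alpha> j) * (L *v \<xi>) $ j) = 0" (is "?l \<longleftrightarrow> ?r") for \<alpha>
  proof
    assume r: ?r
    show ?l
    proof
      fix v assume "v \<in> isotropy L I"
      then obtain c where c: "v = c *s \<xi>" by (rule corank_one_isotropy_line[OF L \<xi>])
      have "(\<Sum>j\<in>- I. of_nat (Poly_Mapping.lookup \<alpha> j) * (L *v v) $ j) =
          c * (\<Sum>j\<in>- I. of_nat (Poly_Mapping.lookup \<alpha> j) * (L *v \<xi>) $ j)"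
        by (simp add: c mult_vec_component sum_distrib_left mult.left_commute)
      then show "(\<Sum>j\<in>- I. of_nat (Poly_Mapping.lookup \<alpha> j) * (L *v v) $ j) = 0"
        using r by simp
    qed
  qed (use \<xi> in blast)
  then show ?thesis by (simp add: resonance_semigroup_def residual_semigroup_def)
qed

end

section \<open>What the envelope determines\<close>

lemma zero_in_residual_semigroup: "0 \<in> residual_semigroup J \<mu>"
  by (simp add: residual_semigroup_def)

lemma residual_semigroup_add:
  assumes "\<alpha> \<in> residual_semigroup J \<mu>" "\<beta> \<in> residual_semigroup J \<mu>"
  shows "\<alpha> + \<beta> \<in> residual_semigroup J \<mu>"
  using assms Poly_Mapping.keys_add[of \<alpha> \<beta>]
  by (auto simp: residual_semigroup_def lookup_add distrib_right sum.distrib)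

lemma residual_semigroup_eqI:
  assumes "\<alpha> \<in> residual_semigroup J \<mu>" "\<beta> \<in> residual_semigroup J \<nu>"
    and "\<And>j. j \<in> J \<Longrightarrow> Poly_Mapping.lookup \<alpha> j = Poly_Mapping.lookup \<beta> j"
  shows "\<alpha> = \<beta>"
proof (rule poly_mapping_eqI)
  fix j
  show "Poly_Mapping.lookup \<alpha> j = Poly_Mapping.lookup \<beta> j"
  proof (cases "j \<in> J")
    case False
    then have "j \<notin> Poly_Mapping.keys \<alpha>" "j \<notin> Poly_Mapping.keys \<beta>"
      using assms(1,2) by (auto simp: residual_semigroup_def)
    then show ?thesis by (simp add: in_keys_iff)
  qed (rule assms(3))
qed

lemma residual_semigroup_difference:
  fixes J :: "'n::finite set"
  assumes "\<alpha> \<in> residual_semigroup J \<mu>" "\<beta> \<in> residual_semigroup J \<mu>" "A \<subseteq> J"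
    and "\<And>j. j \<in> J - A \<Longrightarrow> Poly_Mapping.lookup \<alpha> j = Poly_Mapping.lookup \<beta> j"
  shows "(\<Sum>j\<in>A. (of_nat (Poly_Mapping.lookup \<alpha> j) - of_nat (Poly_Mapping.lookup \<beta> j)) * \<mu> j) = 0"
proof -
  have "(\<Sum>j\<in>A. (of_nat (Poly_Mapping.lookup \<alpha> j) - of_nat (Poly_Mapping.lookup \<beta> j)) * \<mu> j)
      = (\<Sum>j\<in>J. (of_nat (Poly_Mapping.lookup \<alpha> j) - of_nat (Poly_Mapping.lookup \<beta> j)) * \<mu> j)"
    using assms(3,4) by (intro sum.mono_neutral_left) auto
  also have "\<dots> = 0"
    using assms(1,2) by (simp add: residual_semigroup_def left_diff_distrib sum_subtractf)
  finally show ?thesis .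
qed

text \<open>If the minor were nonzero, two elements of S that agree off \<open>{a, b}\<close> would
  agree there too, their difference solving two independent equations in two unknowns. Then the
  other coordinates separate S and the dimension is at most card J - 2. The dimension hypothesis
  adds 1 on the right, which avoids subtraction in \<open>enat\<close>.\<close>

lemma residual_weights_proportional:
  fixes J :: "'n::finite set"
  assumes S: "residual_semigroup J \<mu> = S" "residual_semigroup J \<nu> = S"
    and dim: "enat (card J) \<le> spec_dim (semigroup_algebra S) + 1"
    and ab: "a \<in> J" "b \<in> J"
  shows "\<mu> a * \<nu> b = \<mu> b * \<nu> a"
proof (rule ccontr)
  assume det: "\<mu> a * \<nu> b \<noteq> \<mu> b * \<nu> a"
  then have "a \<noteq> b" by (auto simp: mult.commute)
  let ?K = "J - {a, b}"
  have "inj_on (\<lambda>\<alpha>. \<lambda>k\<in>?K. Poly_Mapping.lookup \<alpha> k) S"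
  proof (rule inj_onI)
    fix \<alpha> \<beta> assume \<alpha>\<beta>: "\<alpha> \<in> S" "\<beta> \<in> S"
      and eq: "(\<lambda>k\<in>?K. Poly_Mapping.lookup \<alpha> k) = (\<lambda>k\<in>?K. Poly_Mapping.lookup \<beta> k)"
    have eqK: "Poly_Mapping.lookup \<alpha> k = Poly_Mapping.lookup \<beta> k" if "k \<in> ?K" for k
      using fun_cong[OF eq, of k] that by simp
    define x :: "'n \<Rightarrow> complex" where
      "x j = of_nat (Poly_Mapping.lookup \<alpha> j) - of_nat (Poly_Mapping.lookup \<beta> j)" for j
    have 1: "x a * \<mu> a + x b * \<mu> b = 0"
      using residual_semigroup_difference[of \<alpha> J \<mu> \<beta> "{a, b}"] \<alpha>\<beta> S eqK ab \<open>a \<noteq> b\<close> by (simp add: x_def)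
    have 2: "x a * \<nu> a + x b * \<nu> b = 0"
      using residual_semigroup_difference[of \<alpha> J \<nu> \<beta> "{a, b}"] \<alpha>\<beta> S eqK ab \<open>a \<noteq> b\<close> by (simp add: x_def)
    \<comment> \<open>Cramer's rule for the equations \<open>1\<close> and \<open>2\<close>.\<close>
    have "x a * (\<mu> a * \<nu> b - \<mu> b * \<nu> a) = (x a * \<mu> a + x b * \<mu> b) * \<nu> b - (x a * \<nu> a + x b * \<nu> b) * \<mu> b"
      by (simp add: algebra_simps)
    then have xa: "x a = 0" using 1 2 det by simp
    have "x b * (\<mu> a * \<nu> b - \<mu> b * \<nu> a) = (x a * \<nu> a + x b * \<nu> b) * \<mu> a - (x a * \<mu> a + x b * \<mu> b) * \<nu> a"
      by (simp add: algebra_simps)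
    then have xb: "x b = 0" using 1 2 det by simp
    show "\<alpha> = \<beta>"
    proof (rule residual_semigroup_eqI[of \<alpha> J \<mu> \<beta> \<mu>])
      show "Poly_Mapping.lookup \<alpha> j = Poly_Mapping.lookup \<beta> j" if "j \<in> J" for j
        using eqK[of j] xa xb that by (cases "j = a \<or> j = b") (auto simp: x_def)
    qed (use \<alpha>\<beta> S in auto)
  qed
  moreover have "0 \<in> S" "\<And>\<alpha> \<beta>. \<alpha> \<in> S \<Longrightarrow> \<beta> \<in> S \<Longrightarrow> \<alpha> + \<beta> \<in> S"
    using S(1) zero_in_residual_semigroup residual_semigroup_add by blast+
  ultimately have "spec_dim (semigroup_algebra S) \<le> enat (card ?K)"
    by (intro spec_dim_semigroup_algebra_le) simp_all
  then have "enat (card J) \<le> enat (card ?K) + 1"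
    using dim by (meson add_right_mono order_trans)
  moreover have "card ?K < card J - 1"
  proof -
    have "card {a, b} \<le> card J" using ab by (intro card_mono) auto
    then show ?thesis using ab \<open>a \<noteq> b\<close> by (simp add: card_Diff_subset)
  qed
  ultimately show False by (simp add: one_enat_def)
qed

lemma residual_semigroup_positive:
  fixes J :: "'n::finite set"
  assumes "\<And>j. j \<in> J \<Longrightarrow> \<mu> j = of_real (f j) \<and> 0 < f j"
  shows "residual_semigroup J \<mu> = {0}"
proof -
  have "\<alpha> = 0" if \<alpha>: "\<alpha> \<in> residual_semigroup J \<mu>" for \<alpha>
  proof (rule residual_semigroup_eqI[OF \<alpha> zero_in_residual_semigroup])
    have "(\<Sum>j\<in>J. of_nat (Poly_Mapping.lookup \<alpha> j) * \<mu> j) = of_real (\<Sum>j\<in>J. real (Poly_Mapping.lookup \<alpha> j) * f j)"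
      using assms by simp
    then have "(\<Sum>j\<in>J. real (Poly_Mapping.lookup \<alpha> j) * f j) = 0"
      using \<alpha> by (simp add: residual_semigroup_def del: of_real_sum)
    moreover have "\<forall>j\<in>J. 0 \<le> real (Poly_Mapping.lookup \<alpha> j) * f j"
      using assms by (simp add: less_imp_le)
    ultimately have "\<forall>j\<in>J. real (Poly_Mapping.lookup \<alpha> j) * f j = 0"
      by (subst (asm) sum_nonneg_eq_0_iff) auto
    then show "Poly_Mapping.lookup \<alpha> j = Poly_Mapping.lookup 0 j" if "j \<in> J" for j
      using that assms by fastforce
  qed
  then show ?thesis using zero_in_residual_semigroup by blast
qed

lemma spec_dim_trivial_semigroup: "spec_dim (semigroup_algebra {0 :: 'n \<Rightarrow>\<^sub>0 nat}) = 0"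
proof -
  have "spec_dim (semigroup_algebra {0 :: 'n \<Rightarrow>\<^sub>0 nat}) \<le> enat (card ({} :: 'n set))"
    by (rule spec_dim_semigroup_algebra_le) auto
  then show ?thesis by (simp flip: zero_enat_def)
qed

lemma envelope_determines_baum_bott:
  fixes J :: "'n::finite set"
  assumes \<phi>: "homogeneous_symmetric J (card J) \<phi>"
    and dim: "enat (card J) \<le> spec_dim (semigroup_algebra S) + 1"
  shows "envelope_determines J S (\<lambda>\<mu>. baum_bott_residue J \<phi> (diag_field J \<mu>))"
  unfolding envelope_determines_def
proof (intro allI impI, elim conjE)
  fix \<mu> \<nu> assume nz: "\<forall>j\<in>J. \<mu> j \<noteq> 0 \<and> \<nu> j \<noteq> 0"
    and S: "residual_semigroup J \<mu> = S" "residual_semigroup J \<nu> = S"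
  have "\<exists>c. c \<noteq> 0 \<and> (\<forall>j\<in>J. \<mu> j = c * \<nu> j)"
  proof (cases "J = {}")
    case False
    then obtain b where b: "b \<in> J" by blast
    then show ?thesis
      using nz residual_weights_proportional[OF S dim _ b]
      by (intro exI[of _ "\<mu> b / \<nu> b"]) (auto simp: field_simps)
  qed (auto intro: exI[of _ 1])
  then obtain c where c: "c \<noteq> 0" "\<And>j. j \<in> J \<Longrightarrow> \<mu> j = c * \<nu> j" by blast
  have bb: "baum_bott_residue J \<phi> (diag_field J \<kappa>) = mpoly_eval \<phi> \<kappa> / (\<Prod>j\<in>J. \<kappa> j)"
    if "\<And>j. j \<in> J \<Longrightarrow> \<kappa> j \<noteq> 0" for \<kappa>
    using that by (rule baum_bott_residue_diagonal[OF \<phi> diagonal_on_diag_field])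
  have "(\<Prod>j\<in>J. \<mu> j) = c ^ card J * (\<Prod>j\<in>J. \<nu> j)"
    using c(2) by (simp add: prod.distrib)
  then show "baum_bott_residue J \<phi> (diag_field J \<mu>) = baum_bott_residue J \<phi> (diag_field J \<nu>)"
    using nz c(1) by (simp add: bb mpoly_eval_scale[OF \<phi> c(2)])
qed

text \<open>If the ratio is determined, S is nontrivial, for the weights (1, 1) and (1, 2) both have
  the trivial semigroup. A nonzero resonance has nonzero exponent at \<open>a\<close> because
  \<open>\<mu> b \<noteq> 0\<close>, so the grading by that exponent gives dimension at least 1; the
  same coordinate separates S, which gives at most 1.\<close>

lemma envelope_determines_cs_iff:
  fixes a b :: "'n::finite"
  assumes ab: "a \<noteq> b" and \<mu>: "\<mu> a \<noteq> 0" "\<mu> b \<noteq> 0" and S: "residual_semigroup {a, b} \<mu> = S"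
  shows "envelope_determines {a, b} S
      (\<lambda>\<mu>. (cs_index (diag_field {a, b} \<mu>) a b, cs_index (diag_field {a, b} \<mu>) b a))
    \<longleftrightarrow> spec_dim (semigroup_algebra S) = enat 1" (is "?l \<longleftrightarrow> ?r")
proof -
  have cs: "cs_index (diag_field {a, b} \<nu>) a b = \<nu> b / \<nu> a" "cs_index (diag_field {a, b} \<nu>) b a = \<nu> a / \<nu> b"
    for \<nu> using ab by (auto intro: cs_index_diagonal diagonal_on_diag_field)
  have S0: "0 \<in> S" and S_add: "\<And>\<alpha> \<beta>. \<alpha> \<in> S \<Longrightarrow> \<beta> \<in> S \<Longrightarrow> \<alpha> + \<beta> \<in> S"
    using S zero_in_residual_semigroup residual_semigroup_add by blast+
  show ?thesis
  proof
    assume ?r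
    then have "enat (card {a, b}) \<le> spec_dim (semigroup_algebra S) + 1"
      using ab by (simp add: one_enat_def)
    then have "\<nu> a * \<kappa> b = \<nu> b * \<kappa> a"
      if "residual_semigroup {a, b} \<nu> = S" "residual_semigroup {a, b} \<kappa> = S" for \<nu> \<kappa>
      using residual_weights_proportional[OF that] by simp
    then show ?l
      unfolding envelope_determines_def cs by (auto simp: field_simps)
  next
    assume l: ?l
    have "S \<noteq> {0}"
    proof
      assume "S = {0}"
      then have "residual_semigroup {a, b} (\<lambda>_. 1) = S"
          "residual_semigroup {a, b} (\<lambda>j. if j = b then 2 else 1) = S"
        using residual_semigroup_positive[of "{a, b}" "\<lambda>_. 1" "\<lambda>_. 1"]
          residual_semigroup_positive[of "{a, b}" "\<lambda>j. if j = b then 2 else 1" "\<lambda>j. if j = b then 2 else 1"]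
        by auto
      then have "(1::complex) / 1 = (if b = b then 2 else 1) / (if a = b then 2 else 1)"
        using l[unfolded envelope_determines_def cs, rule_format,
            of "\<lambda>_. 1" "\<lambda>j. if j = b then 2 else 1"] by auto
      then show False using ab by simp
    qed
    then obtain \<alpha> where \<alpha>: "\<alpha> \<in> S" "\<alpha> \<noteq> 0" using S0 by blast
    have rel: "of_nat (Poly_Mapping.lookup \<alpha> a) * \<mu> a + of_nat (Poly_Mapping.lookup \<alpha> b) * \<mu> b = 0"
      using \<alpha>(1) S ab by (auto simp: residual_semigroup_def)
    have "Poly_Mapping.lookup \<alpha> a \<noteq> 0"
    proof
      assume "Poly_Mapping.lookup \<alpha> a = 0"
      then have "\<alpha> = 0"
        using rel \<mu> \<alpha>(1) S by (intro residual_semigroup_eqI[of _ "{a, b}" \<mu> _ \<mu>] zero_in_residual_semigroup) auto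
      then show False using \<alpha>(2) by simp
    qed
    then have "enat 1 \<le> spec_dim (semigroup_algebra S)"
      using \<alpha>(1) by (intro spec_dim_semigroup_algebra_ge_one[OF S0 S_add, of "\<lambda>\<alpha>. Poly_Mapping.lookup \<alpha> a"])
        (simp_all add: lookup_add)
    moreover have "spec_dim (semigroup_algebra S) \<le> enat (card {a})"
    proof (rule spec_dim_semigroup_algebra_le[OF S0 S_add])
      show "inj_on (\<lambda>\<alpha>. \<lambda>k\<in>{a}. Poly_Mapping.lookup \<alpha> k) S"
      proof (rule inj_onI)
        fix \<beta> \<gamma> assume \<beta>\<gamma>: "\<beta> \<in> S" "\<gamma> \<in> S"
          and "(\<lambda>k\<in>{a}. Poly_Mapping.lookup \<beta> k) = (\<lambda>k\<in>{a}. Poly_Mapping.lookup \<gamma> k)"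
        then have eq: "Poly_Mapping.lookup \<beta> a = Poly_Mapping.lookup \<gamma> a"
          by (metis restrict_apply singletonI)
        then have "(\<Sum>j\<in>{b}. (of_nat (Poly_Mapping.lookup \<beta> j) - of_nat (Poly_Mapping.lookup \<gamma> j)) * \<mu> j) = 0"
          using \<beta>\<gamma> S by (intro residual_semigroup_difference[of _ "{a, b}"]) auto
        then show "\<beta> = \<gamma>"
          using eq \<mu> \<beta>\<gamma> S by (intro residual_semigroup_eqI[of _ "{a, b}" \<mu> _ \<mu>]) auto
      qed
    qed auto
    ultimately show ?r by simp
  qed
qed

section \<open>Families with trivial envelope\<close>

text \<open>The description has the zero vector as its only solution, by independence of the support
  weights. Independence is stated for the set of weights, hence the passage from indices to their
  images.\<close>

lemma conn_coeff_zero: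
  assumes L: "corank_one_support L I"
  shows "conn_coeff L I 0 = (\<lambda>_. 0)"
  unfolding conn_coeff_def
proof (rule the_equality)
  fix c assume c: "(\<forall>i. i \<notin> I \<longrightarrow> c i = 0) \<and>
    (\<Sum>j\<in>- I. of_nat (Poly_Mapping.lookup 0 j) *s L $ j) = (\<Sum>i\<in>I. c i *s L $ i)"
  have inj: "inj_on (($) L) I" and ind: "vec.independent (($) L ` I)"
    using L by (auto simp: corank_one_support_def)
  have "(\<Sum>x\<in>($) L ` I. c (the_inv_into I (($) L) x) *s x) = (\<Sum>i\<in>I. c i *s L $ i)"
    by (simp add: sum.reindex[OF inj] the_inv_into_f_f[OF inj])
  then have zero: "(\<Sum>x\<in>($) L ` I. c (the_inv_into I (($) L) x) *s x) = 0" using c by simp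
  have "c i = 0" if "i \<in> I" for i
    using vec.independentD[OF ind _ subset_refl zero, of "L $ i"] that by (simp add: the_inv_into_f_f[OF inj])
  then show "c = (\<lambda>_. 0)" using c by auto
qed simp

text \<open>Sections have only a constant term, which \<open>conn_delta\<close> kills. The
  right-hand side depends on \<open>L\<close> no longer, so actions with the same support and
  trivial semigroup share their connection.\<close>

lemma log_connection_trivial:
  assumes L: "corank_one_support L I" and S: "resonance_semigroup L I = {0}"
  shows "log_connection L I =
    (\<lambda>s\<in>conn_sections I {0}. \<lambda>i\<in>I. \<lambda>z\<in>{z. support z = I}. \<lambda>\<alpha>.
        deriv (\<lambda>t. Poly_Mapping.lookup (s (upd z i t)) \<alpha>) (z $ i))"
  unfolding log_connection_def S
proof (intro restrict_ext ext)
  fix s :: "complex ^ 'b \<Rightarrow> 'b cpoly" and i z \<alpha>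
  assume s: "s \<in> conn_sections I {0}" and z: "z \<in> {z. support z = I}"
  have "Poly_Mapping.keys (s z) \<subseteq> {0}" using s z by (fastforce simp: conn_sections_def)
  then have "Poly_Mapping.lookup (conn_delta L I i (s z)) \<alpha> = 0"
    by (auto simp: conn_delta_def lookup_mapp when_def conn_coeff_zero[OF L])
  then show "deriv (\<lambda>t. Poly_Mapping.lookup (s (upd z i t)) \<alpha>) (z $ i) -
      Poly_Mapping.lookup (conn_delta L I i (s z)) \<alpha> / z $ i =
      deriv (\<lambda>t. Poly_Mapping.lookup (s (upd z i t)) \<alpha>) (z $ i)"
    by simp
qed

lemma monodromy_trivial:
  assumes L: "corank_one_support L I" and S: "resonance_semigroup L I = {0}"
  shows "monodromy L I = (\<lambda>i\<in>I. \<lambda>p\<in>carrier (semigroup_algebra {0}). p)"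
  unfolding monodromy_def S
proof (intro restrict_ext poly_mapping_eqI)
  fix i \<alpha> and p :: "'b cpoly"
  assume "p \<in> carrier (semigroup_algebra {0})"
  then have "\<alpha> = 0 \<or> Poly_Mapping.lookup p \<alpha> = 0" by (auto simp: in_keys_iff)
  then show "Poly_Mapping.lookup (Poly_Mapping.mapp
      (\<lambda>\<alpha> a. exp (2 * of_real pi * \<i> * conn_coeff L I \<alpha> i) * a) p) \<alpha> = Poly_Mapping.lookup p \<alpha>"
    by (auto simp: lookup_mapp when_def in_keys_iff conn_coeff_zero[OF L])
qed

text \<open>The support weights are the coordinate forms other than the one for \<open>k\<close> and
  stay fixed; on the isotropy line, the \<open>k\<close>-axis, the residual weights are 1 and
  \<open>t\<close>, so only their ratio moves.\<close>

definition split_family :: "'n \<Rightarrow> 'n \<Rightarrow> 'k \<Rightarrow> ('n \<Rightarrow> 'k) \<Rightarrow> real \<Rightarrow> complex ^ 'k ^ 'n" where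
  "split_family a b k g t =
     (\<chi> i. if i = a then axis k 1 else if i = b then axis k (of_real t) else axis (g i) 1)"

context
  fixes a b :: "'n::finite" and k :: "'k::finite" and g :: "'n \<Rightarrow> 'k"
  assumes ab: "a \<noteq> b" and g: "bij_betw g (- {a, b}) (- {k})"
begin

lemma split_family_mult:
  "(split_family a b k g t *v v) $ i =
    (if i = a then v $ k else if i = b then of_real t * v $ k else v $ g i)"
proof -
  have "(\<Sum>l\<in>UNIV. axis m c $ l * v $ l) = c * v $ m" for m and c :: complex
    by (simp add: axis_def if_distrib[of "\<lambda>x. x * _"] cong: if_cong)
  then show ?thesis by (simp add: split_family_def matrix_vector_mult_def)
qed

lemma isotropy_split_family: "axis k 1 \<in> isotropy (split_family a b k g t) (- {a, b})"
proof -
  have "g i \<noteq> k" if "i \<notin> {a, b}" for i using g that by (auto simp: bij_betw_def)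
  then show ?thesis by (auto simp: isotropy_def split_family_mult axis_def)
qed

lemma corank_one_split_family:
  assumes "t \<noteq> 0"
  shows "corank_one_support (split_family a b k g t) (- {a, b})"
  unfolding corank_one_support_def
proof (intro conjI)
  let ?L = "split_family a b k g t"
  have L: "?L $ i = axis (g i) 1" if "i \<in> - {a, b}" for i
    using that by (simp add: split_family_def)
  have inj: "inj_on g (- {a, b})" and img: "g ` (- {a, b}) = - {k}" using g by (auto simp: bij_betw_def)
  have "cart_basis \<subseteq> range (($) ?L)"
  proof
    fix x :: "complex ^ 'k" assume "x \<in> cart_basis"
    then obtain l where x: "x = axis l 1" by (auto simp: cart_basis_def)
    show "x \<in> range (($) ?L)"
    proof (cases "l = k")
      case True
      then show ?thesis by (intro image_eqI[of _ _ a]) (simp_all add: x split_family_def)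
    next
      case False
      then obtain i where "i \<in> - {a, b}" "l = g i" using img by auto
      then show ?thesis by (intro image_eqI[of _ _ i]) (simp_all add: x L)
    qed
  qed
  then have "vec.span cart_basis \<subseteq> vec.span (range (($) ?L))" by (rule vec.span_mono)
  then show "vec.span (range (($) ?L)) = UNIV" by (simp add: span_cart_basis top.extremum_unique)
  have "card (- {a, b}) = card (- {k})" using g by (rule bij_betw_same_card)
  then show "card (- {a, b}) + 1 = CARD('k)" by (simp add: Compl_eq_Diff_UNIV card_Diff_subset)
  show "inj_on (($) ?L) (- {a, b})"
  proof (rule inj_onI)
    fix i j assume ij: "i \<in> - {a, b}" "j \<in> - {a, b}" and "?L $ i = ?L $ j"
    then have "axis (g i) (1 :: complex) = axis (g j) 1" by (simp add: L)
    then have "g i = g j" by (simp add: axis_eq_axis)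
    then show "i = j" using inj ij by (simp add: inj_on_eq_iff)
  qed
  have "($) ?L ` (- {a, b}) \<subseteq> cart_basis" by (auto simp: L cart_basis_def)
  then show "vec.independent (($) ?L ` (- {a, b}))"
    using independent_cart_basis vec.independent_mono by blast
  show "\<forall>j\<in>- (- {a, b}). \<exists>v\<in>isotropy ?L (- {a, b}). (?L *v v) $ j \<noteq> 0"
    using assms isotropy_split_family by (intro ballI bexI[of _ "axis k 1"]) (auto simp: split_family_mult)
qed

lemma poincare_domain_split_family: "0 < t \<Longrightarrow> poincare_domain (split_family a b k g t)"
  unfolding poincare_domain_def by (intro exI[of _ "\<chi> _. 1"]) (simp add: split_family_mult)

lemma resonance_semigroup_split_family:
  assumes "0 < t"
  shows "resonance_semigroup (split_family a b k g t) (- {a, b}) = {0}"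
proof -
  have nz: "t \<noteq> 0" using assms by simp
  have "axis k 1 \<noteq> (0 :: complex ^ 'k)" by (simp add: axis_eq_0_iff)
  note resonance_semigroup_eq_residual[OF corank_one_split_family[OF nz] isotropy_split_family this]
  moreover have "residual_semigroup {a, b} (($) (split_family a b k g t *v axis k 1)) = {0}"
    by (rule residual_semigroup_positive[of _ _ "\<lambda>j. if j = a then 1 else t"])
      (auto simp: split_family_mult axis_def assms)
  ultimately show ?thesis by simp
qed

lemma transverse_cs_split_family:
  assumes "0 < t"
  shows "transverse_cs (split_family a b k g t) (- {a, b}) a b = of_real t"
    and "transverse_cs (split_family a b k g t) (- {a, b}) b a = 1 / of_real t"
proof -
  have nz: "t \<noteq> 0" using assms by simp
  have "axis k 1 \<noteq> (0 :: complex ^ 'k)" by (simp add: axis_eq_0_iff)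
  note cs = transverse_cs_eq[OF corank_one_split_family[OF nz] isotropy_split_family this]
  show "transverse_cs (split_family a b k g t) (- {a, b}) a b = of_real t"
    using cs[of a b] ab by (simp add: split_family_mult)
  show "transverse_cs (split_family a b k g t) (- {a, b}) b a = 1 / of_real t"
    using cs[of b a] ab by (simp add: split_family_mult)
qed

end

lemma indistinguishable_family_exists:
  assumes n: "CARD('n::finite) = CARD('k::finite) + 1"
  shows "\<exists>(L :: real \<Rightarrow> complex ^ 'k ^ 'n) I j\<^sub>1 j\<^sub>2. j\<^sub>1 \<noteq> j\<^sub>2 \<and> - I = {j\<^sub>1, j\<^sub>2} \<and>
           (\<forall>t>0. corank_one_support (L t) I \<and> poincare_domain (L t) \<and>
              envelope_dim (L t) I < enat (CARD('n) - CARD('k))) \<and>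
           (\<forall>s>0. \<forall>t>0. s \<noteq> t \<longrightarrow>
              resonance_semigroup (L s) I = resonance_semigroup (L t) I \<and>
              log_connection (L s) I = log_connection (L t) I \<and>
              monodromy (L s) I = monodromy (L t) I \<and>
              transverse_cs (L s) I j\<^sub>1 j\<^sub>2 \<noteq> transverse_cs (L t) I j\<^sub>1 j\<^sub>2 \<and>
              transverse_cs (L s) I j\<^sub>2 j\<^sub>1 \<noteq> transverse_cs (L t) I j\<^sub>2 j\<^sub>1)"
proof -
  have "\<not> CARD('n) \<le> Suc 0" using n by simp
  then obtain a b :: 'n where ab: "a \<noteq> b"
    using card_le_Suc0_iff_eq[of "UNIV :: 'n set"] by auto
  obtain k :: 'k where True by blast
  \<comment> \<open>Both complements have k - 1 elements because n = k + 1; a bijection between them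
    assigns the remaining coordinate forms to the support.\<close>
  have "card (- {a, b}) = card (- {k})" using ab n by (simp add: Compl_eq_Diff_UNIV card_Diff_subset)
  then obtain g where g: "bij_betw g (- {a, b}) (- {k})"
    using finite_same_card_bij[OF finite finite] by blast
  let ?L = "split_family a b k g" and ?I = "- {a, b}"
  have corank: "corank_one_support (?L t) ?I" if "0 < t" for t
    using corank_one_split_family[OF ab g] that by simp
  note S = resonance_semigroup_split_family[OF ab g]
  note cs = transverse_cs_split_family[OF ab g]
  show ?thesis
  proof (rule exI[of _ ?L], rule exI[of _ ?I], rule exI[of _ a], rule exI[of _ b],
      intro conjI allI impI)
    fix t :: real assume t: "0 < t"
    show "corank_one_support (?L t) ?I" using corank[OF t] .
    show "poincare_domain (?L t)" by (rule poincare_domain_split_family[OF ab g t])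
    show "envelope_dim (?L t) ?I < enat (CARD('n) - CARD('k))"
      using n by (simp add: envelope_dim_def S[OF t] spec_dim_trivial_semigroup zero_enat_def)
  next
    fix s t :: real assume st: "0 < s" "0 < t" "s \<noteq> t"
    show "resonance_semigroup (?L s) ?I = resonance_semigroup (?L t) ?I"
      using S st by simp
    show "log_connection (?L s) ?I = log_connection (?L t) ?I"
      using log_connection_trivial[OF corank S] st by simp
    show "monodromy (?L s) ?I = monodromy (?L t) ?I"
      using monodromy_trivial[OF corank S] st by simp
    show "transverse_cs (?L s) ?I a b \<noteq> transverse_cs (?L t) ?I a b"
      "transverse_cs (?L s) ?I b a \<noteq> transverse_cs (?L t) ?I b a"
      using cs st by simp_all
  qed (use ab in auto)
qed

theorem mainTheorem3:
  shows
    "(\<forall>(L :: complex ^ 'k::finite ^ 'n::finite) I. corank_one_support L I \<longrightarrow>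
        irreducible_component (coord_space I) (singular_locus L) \<and>
        (\<forall>q \<xi>. CARD('n) = CARD('k) + q \<and> 1 \<le> q \<and> \<xi> \<in> isotropy L I \<and> \<xi> \<noteq> 0 \<longrightarrow>
          (\<forall>p. support p = I \<longrightarrow>
             generates_transverse L I p (diag_field (- I) (($) (L *v \<xi>)))) \<and>
          (\<forall>\<phi>. homogeneous_symmetric (- I) (q + 1) \<phi> \<longrightarrow>
             baum_bott \<phi> L I = mpoly_eval \<phi> (($) (L *v \<xi>)) / (\<Prod>j\<in>- I. (L *v \<xi>) $ j)) \<and>
          (full_resonance_rank L I \<longrightarrow>
             (\<forall>\<phi>. homogeneous_symmetric (- I) (q + 1) \<phi> \<longrightarrow>
                envelope_determines (- I) (resonance_semigroup L I)
                  (\<lambda>\<mu>. baum_bott_residue (- I) \<phi> (diag_field (- I) \<mu>)))) \<and>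
          (\<forall>j\<^sub>1 j\<^sub>2. q = 1 \<and> j\<^sub>1 \<noteq> j\<^sub>2 \<and> - I = {j\<^sub>1, j\<^sub>2} \<longrightarrow>
             (transverse_cs L I j\<^sub>1 j\<^sub>2, transverse_cs L I j\<^sub>2 j\<^sub>1) =
               ((L *v \<xi>) $ j\<^sub>2 / (L *v \<xi>) $ j\<^sub>1, (L *v \<xi>) $ j\<^sub>1 / (L *v \<xi>) $ j\<^sub>2) \<and>
             (envelope_determines (- I) (resonance_semigroup L I)
                (\<lambda>\<mu>. (cs_index (diag_field (- I) \<mu>) j\<^sub>1 j\<^sub>2, cs_index (diag_field (- I) \<mu>) j\<^sub>2 j\<^sub>1))
              \<longleftrightarrow> full_resonance_rank L I))))
     \<and> (2 \<le> CARD('k) \<and> CARD('n) = CARD('k) + 1 \<longrightarrow>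
        (\<exists>(L :: real \<Rightarrow> complex ^ 'k ^ 'n) I j\<^sub>1 j\<^sub>2. j\<^sub>1 \<noteq> j\<^sub>2 \<and> - I = {j\<^sub>1, j\<^sub>2} \<and>
           (\<forall>t>0. corank_one_support (L t) I \<and> poincare_domain (L t) \<and>
              envelope_dim (L t) I < enat (CARD('n) - CARD('k))) \<and>
           (\<forall>s>0. \<forall>t>0. s \<noteq> t \<longrightarrow>
              resonance_semigroup (L s) I = resonance_semigroup (L t) I \<and>
              log_connection (L s) I = log_connection (L t) I \<and>
              monodromy (L s) I = monodromy (L t) I \<and>
              transverse_cs (L s) I j\<^sub>1 j\<^sub>2 \<noteq> transverse_cs (L t) I j\<^sub>1 j\<^sub>2 \<and>
              transverse_cs (L s) I j\<^sub>2 j\<^sub>1 \<noteq> transverse_cs (L t) I j\<^sub>2 j\<^sub>1)))"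
proof (intro conjI allI impI)
  fix L :: "complex ^ 'k ^ 'n" and I
  assume L: "corank_one_support L I"
  show "irreducible_component (coord_space I) (singular_locus L)"
    by (rule coord_space_irreducible_component[OF L])
  fix q \<xi>
  assume "CARD('n) = CARD('k) + q \<and> 1 \<le> q \<and> \<xi> \<in> isotropy L I \<and> \<xi> \<noteq> 0"
  then have n: "CARD('n) = CARD('k) + q" and q: "1 \<le> q" and \<xi>: "\<xi> \<in> isotropy L I" "\<xi> \<noteq> 0"
    by auto
  have cardI: "card I + 1 = CARD('k)" using L by (simp add: corank_one_support_def)
  then have cardJ: "card (- I) = q + 1" using n by (simp add: Compl_eq_Diff_UNIV card_Diff_subset)
  have dim: "full_resonance_rank L I \<longleftrightarrow> spec_dim (semigroup_algebra (resonance_semigroup L I)) = enat q"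
    using n by (simp add: full_resonance_rank_def envelope_dim_def)
  show "generates_transverse L I p (diag_field (- I) (($) (L *v \<xi>)))" if "support p = I" for p
    using generates_transverse_diag_field[OF L \<xi> that] .
  show "baum_bott \<phi> L I = mpoly_eval \<phi> (($) (L *v \<xi>)) / (\<Prod>j\<in>- I. (L *v \<xi>) $ j)"
    if "homogeneous_symmetric (- I) (q + 1) \<phi>" for \<phi>
    using that by (intro baum_bott_eq[OF L \<xi>]) (simp add: cardJ)
  show "envelope_determines (- I) (resonance_semigroup L I)
      (\<lambda>\<mu>. baum_bott_residue (- I) \<phi> (diag_field (- I) \<mu>))"
    if "full_resonance_rank L I" "homogeneous_symmetric (- I) (q + 1) \<phi>" for \<phi>
    using that by (intro envelope_determines_baum_bott) (simp_all add: cardJ dim one_enat_def)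
  fix j\<^sub>1 j\<^sub>2
  assume *: "q = 1 \<and> j\<^sub>1 \<noteq> j\<^sub>2 \<and> - I = {j\<^sub>1, j\<^sub>2}"
  then have J: "- I = {j\<^sub>1, j\<^sub>2}" and j: "j\<^sub>1 \<noteq> j\<^sub>2" by auto
  show "(transverse_cs L I j\<^sub>1 j\<^sub>2, transverse_cs L I j\<^sub>2 j\<^sub>1) =
      ((L *v \<xi>) $ j\<^sub>2 / (L *v \<xi>) $ j\<^sub>1, (L *v \<xi>) $ j\<^sub>1 / (L *v \<xi>) $ j\<^sub>2)"
    using transverse_cs_eq[OF L \<xi>] J j by simp
  have nz: "(L *v \<xi>) $ j\<^sub>1 \<noteq> 0" "(L *v \<xi>) $ j\<^sub>2 \<noteq> 0"
    using residual_weight_nonzero[OF L \<xi>] J by auto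
  have S: "residual_semigroup {j\<^sub>1, j\<^sub>2} (($) (L *v \<xi>)) = resonance_semigroup L I"
    by (simp add: resonance_semigroup_eq_residual[OF L \<xi>] J)
  show "envelope_determines (- I) (resonance_semigroup L I)
      (\<lambda>\<mu>. (cs_index (diag_field (- I) \<mu>) j\<^sub>1 j\<^sub>2, cs_index (diag_field (- I) \<mu>) j\<^sub>2 j\<^sub>1))
    \<longleftrightarrow> full_resonance_rank L I"
    using envelope_determines_cs_iff[OF j nz S] * unfolding J dim by simp
qed (use indistinguishable_family_exists in blast)

end
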